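(* The rectangular quadrant $\mathbf Q=\mathbb L_{\ge0}\times\mathbb L_{\ge0}$ has a (dimension-one) foliation tangent to the boundary, while the rhombic quadrant $\overline Q=\{(x,y)\in\mathbb L^2:-y\le x\le y\}$ does not have one. In particular $\mathbf Q$ and $\overline Q$ are not homeomorphic.
   Context: The closed long ray $\mathbb L_{\ge 0}$ is $\omega_1\times[0,1)$ with the order topology of the lexicographic order. The long line $\mathbb L$ is the double of $\mathbb L_{\ge0}$: two copies of $\mathbb L_{\ge 0}$ glued at $0$, linearly ordered with the second copy reversed and placed below $0$; $x\mapsto -x$ is the order-reversing involution exchanging the copies. Both $\mathbf Q$ and $\overline Q$ are regarded as topological surfaces-with-boundary; the boundary of $\mathbf Q$ is $(\mathbb L_{\ge0}\times\{0\})\cup(\{0\}\times\mathbb L_{\ge0})$ and that of $\overline Q$ is $\{(x,y)\in\overline Q: x=y\text{ or }x=-y\}$. A dimension-one foliation on a surface-with-boundary, tangent to the boundary, is a maximal atlas of charts $\varphi_i:U_i\to\mathbb R\times[0,\infty)$ (homeomorphisms onto open subsets, boundary points corresponding to $\mathbb R\times\{0\}$) whose coordinate changes have the form $\varphi_j\varphi_i^{-1}(x,y)=(g_{i,j}(x,y),h_{i,j}(y))$ (only continuity is required); the leaves are the path components of the topology generated by the components of the sets $\varphi_i^{-1}(\mathbb R\times\{y\})$, and each boundary component is then a leaf. *)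

theory Defs
  imports "HOL-Analysis.Analysis" "HOL-Library.Countable_Set_Type"
begin

section \<open>The first uncountable ordinal\<close>

text \<open>
  The cardinal successor of the standard well-order of \<^typ>\<open>nat\<close> is an initial ordinal, hence
  a well-order of type \<open>\<omega>\<^sub>1\<close>; see \<open>uncountable_omega1\<close> and \<open>countable_lessThan_omega1\<close> below.
\<close>

lemma Card_order_omega1: "Card_order (cardSuc natLeq)"
  by (simp add: cardSuc_Card_order natLeq_Card_order)

lemma Field_omega1_nonempty: "Field (cardSuc natLeq) \<noteq> {}"
proof -
  have "infinite (Field (cardSuc natLeq))"
    using cardSuc_finite[OF natLeq_Card_order] Field_natLeq infinite_UNIV_nat by metis
  then show ?thesis by auto
qed

typedef omega1 = "Field (cardSuc natLeq)"
  using Field_omega1_nonempty by blast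

instantiation omega1 :: linorder
begin

definition less_eq_omega1 :: "omega1 \<Rightarrow> omega1 \<Rightarrow> bool" where
  "a \<le> b \<longleftrightarrow> (Rep_omega1 a, Rep_omega1 b) \<in> cardSuc natLeq"

definition less_omega1 :: "omega1 \<Rightarrow> omega1 \<Rightarrow> bool" where
  "a < b \<longleftrightarrow> a \<le> b \<and> a \<noteq> (b :: omega1)"

instance
proof
  have wo: "Well_order (cardSuc natLeq)"
    using Card_order_omega1 by (simp add: card_order_on_def)
  then have lin: "Linear_order (cardSuc natLeq)"
    by (simp add: well_order_on_def)
  have refl: "Refl (cardSuc natLeq)" and trans: "trans (cardSuc natLeq)"
    and anti: "antisym (cardSuc natLeq)" and tot: "Total (cardSuc natLeq)"
    using lin by (auto simp: linear_order_on_def partial_order_on_def preorder_on_def)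
  show le_refl: "a \<le> a" for a :: omega1
    using refl Rep_omega1[of a] by (auto simp: less_eq_omega1_def refl_on_def)
  show "a \<le> b \<Longrightarrow> b \<le> c \<Longrightarrow> a \<le> c" for a b c :: omega1
    using trans unfolding less_eq_omega1_def by (meson transD)
  show le_anti: "a \<le> b \<Longrightarrow> b \<le> a \<Longrightarrow> a = b" for a b :: omega1
    using anti unfolding less_eq_omega1_def by (meson antisymD Rep_omega1_inject)
  show "a < b \<longleftrightarrow> a \<le> b \<and> \<not> b \<le> a" for a b :: omega1
    using le_refl le_anti unfolding less_omega1_def by blast
  show "a \<le> b \<or> b \<le> a" for a b :: omega1
    using tot refl Rep_omega1[of a] Rep_omega1[of b] Rep_omega1_inject[of a b]
    unfolding less_eq_omega1_def total_on_def refl_on_def by metis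
qed

end

instance omega1 :: wellorder
proof
  fix P :: "omega1 \<Rightarrow> bool" and a :: omega1
  assume step: "\<And>x. (\<And>y. y < x \<Longrightarrow> P y) \<Longrightarrow> P x"
  have "wf (cardSuc natLeq - Id)"
    using Card_order_omega1 by (simp add: card_order_on_def well_order_on_def)
  then have "wf (inv_image (cardSuc natLeq - Id) Rep_omega1)"
    by (rule wf_inv_image)
  then show "P a"
    by (induction a rule: wf_induct_rule)
      (rule step, simp add: in_inv_image less_omega1_def less_eq_omega1_def Rep_omega1_inject)
qed

lemma uncountable_omega1: "uncountable (UNIV :: omega1 set)"
proof
  include cardinal_syntax
  assume "countable (UNIV :: omega1 set)"
  then have "countable (range Rep_omega1)" by blast
  then have "|Field (cardSuc natLeq)| \<le>o natLeq"
    using type_definition.Rep_range[OF type_definition_omega1]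
    by (simp add: countable_card_le_natLeq)
  then have "cardSuc natLeq \<le>o natLeq"
    using card_of_Field_ordIso[OF Card_order_omega1] ordIso_ordLeq_trans ordIso_symmetric by blast
  then show False
    using cardSuc_greater[OF natLeq_Card_order] not_ordLess_ordLeq by blast
qed

lemma countable_lessThan_omega1: "countable {..<a :: omega1}"
proof -
  include cardinal_syntax
  let ?U = "underS (cardSuc natLeq) (Rep_omega1 a)"
  have "|?U| <o cardSuc natLeq"
    using card_of_underS[OF Card_order_omega1 Rep_omega1] .
  then have "|?U| \<le>o natLeq"
    using cardSuc_ordLeq_ordLess[OF natLeq_Card_order card_of_Card_order] by blast
  then have "countable ?U" by (simp add: countable_card_le_natLeq)
  moreover have "Rep_omega1 ` {..<a} \<subseteq> ?U"
    by (auto simp: underS_def less_omega1_def less_eq_omega1_def Rep_omega1_inject)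
  ultimately have "countable (Rep_omega1 ` {..<a})"
    using countable_subset by blast
  then show ?thesis
    by (rule countable_image_inj_on) (meson Rep_omega1_inject inj_onI)
qed


section \<open>The closed long ray and the long line\<close>

typedef long_ray = "(UNIV :: omega1 set) \<times> {0..<1 :: real}"
  by (rule exI[of _ "(undefined, 0)"]) simp

instantiation long_ray :: linorder
begin

definition less_eq_long_ray :: "long_ray \<Rightarrow> long_ray \<Rightarrow> bool" where
  "x \<le> y \<longleftrightarrow> fst (Rep_long_ray x) < fst (Rep_long_ray y) \<or>
     fst (Rep_long_ray x) = fst (Rep_long_ray y) \<and> snd (Rep_long_ray x) \<le> snd (Rep_long_ray y)"

definition less_long_ray :: "long_ray \<Rightarrow> long_ray \<Rightarrow> bool" where
  "x < y \<longleftrightarrow> x \<le> y \<and> \<not> y \<le> (x :: long_ray)"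

instance
  by standard
    (auto simp: less_eq_long_ray_def less_long_ray_def
      Rep_long_ray_inject[symmetric] prod_eq_iff)

end

instantiation long_ray :: linorder_topology
begin

definition open_long_ray :: "long_ray set \<Rightarrow> bool" where
  "open_long_ray = generate_topology (range (\<lambda>a. {..<a}) \<union> range (\<lambda>a. {a<..}))"

instance
  by standard (rule open_long_ray_def)

end

instantiation long_ray :: zero
begin

definition zero_long_ray :: long_ray where
  "0 = Abs_long_ray (LEAST a. True, 0)"

instance ..

end

lemma zero_le_long_ray: "0 \<le> (x :: long_ray)"
proof -
  have "(LEAST a. True) \<le> fst (Rep_long_ray x)" by (rule Least_le) simp
  moreover have "0 \<le> snd (Rep_long_ray x)" using Rep_long_ray[of x] by auto
  ultimately show ?thesis
    by (auto simp: less_eq_long_ray_def zero_long_ray_def Abs_long_ray_inverse)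
qed

text \<open>
  The left summand is the reversed copy of the long ray; the gluing of the two zeros is realised
  by omitting \<open>0\<close> from it.
\<close>

typedef long_line = "UNIV - {Inl 0} :: (long_ray + long_ray) set"
  by blast

instantiation long_line :: linorder
begin

definition less_eq_long_line :: "long_line \<Rightarrow> long_line \<Rightarrow> bool" where
  "x \<le> y \<longleftrightarrow>
    (case (Rep_long_line x, Rep_long_line y) of
       (Inr a, Inr b) \<Rightarrow> a \<le> b
     | (Inl a, Inl b) \<Rightarrow> b \<le> a
     | (Inl _, Inr _) \<Rightarrow> True
     | (Inr _, Inl _) \<Rightarrow> False)"

definition less_long_line :: "long_line \<Rightarrow> long_line \<Rightarrow> bool" where
  "x < y \<longleftrightarrow> x \<le> y \<and> \<not> y \<le> (x :: long_line)"

instance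
  by standard
    (auto simp: less_eq_long_line_def less_long_line_def
      Rep_long_line_inject[symmetric] split: sum.splits)

end

instantiation long_line :: linorder_topology
begin

definition open_long_line :: "long_line set \<Rightarrow> bool" where
  "open_long_line = generate_topology (range (\<lambda>a. {..<a}) \<union> range (\<lambda>a. {a<..}))"

instance
  by standard (rule open_long_line_def)

end

instantiation long_line :: uminus
begin

definition uminus_long_line :: "long_line \<Rightarrow> long_line" where
  "- x = Abs_long_line
     (case Rep_long_line x of Inl a \<Rightarrow> Inr a | Inr a \<Rightarrow> if a = 0 then Inr 0 else Inl a)"

instance ..

end

lemma Rep_uminus_long_line:
  "Rep_long_line (- x) =
     (case Rep_long_line x of Inl a \<Rightarrow> Inr a | Inr a \<Rightarrow> if a = 0 then Inr 0 else Inl a)"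
  unfolding uminus_long_line_def
  by (subst Abs_long_line_inverse) (auto split: sum.splits)

lemma minus_minus_long_line: "- (- x) = (x :: long_line)"
  using Rep_long_line[of x]
  by (auto simp: Rep_uminus_long_line Rep_long_line_inject[symmetric] split: sum.splits)

lemma neg_le_neg_long_line: "- x \<le> - y \<longleftrightarrow> y \<le> (x :: long_line)"
proof -
  have "a \<le> 0 \<longleftrightarrow> a = 0" for a :: long_ray
    using zero_le_long_ray[of a] by auto
  then show ?thesis
    using Rep_long_line[of x] Rep_long_line[of y]
    by (auto simp: Rep_uminus_long_line less_eq_long_line_def zero_le_long_ray split: sum.splits)
qed


section \<open>The two quadrants\<close>

definition rect_quadrant :: "(long_ray \<times> long_ray) set" where
  "rect_quadrant = UNIV"

definition rect_boundary :: "(long_ray \<times> long_ray) set" where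
  "rect_boundary = (UNIV \<times> {0}) \<union> ({0} \<times> UNIV)"

definition rhombic_quadrant :: "(long_line \<times> long_line) set" where
  "rhombic_quadrant = {(x, y). - y \<le> x \<and> x \<le> y}"

definition rhombic_boundary :: "(long_line \<times> long_line) set" where
  "rhombic_boundary = {(x, y) \<in> rhombic_quadrant. x = y \<or> x = - y}"


section \<open>Foliations tangent to the boundary\<close>

definition half_plane :: "(real \<times> real) set" where
  "half_plane = UNIV \<times> {0..}"

text \<open>
  In what follows \<open>M\<close> is a surface-with-boundary, as a subspace of the ambient type, and \<open>B\<close> is its
  boundary. A chart is a pair \<open>(U, \<phi>)\<close> with \<open>\<phi>\<close> undefined outside \<open>U\<close>, so that it is determined
  by its values on its domain.
\<close>

type_synonym 'a chart = "'a set \<times> ('a \<Rightarrow> real \<times> real)"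

definition boundary_chart ::
  "'a::topological_space set \<Rightarrow> 'a set \<Rightarrow> 'a chart \<Rightarrow> bool" where
  "boundary_chart M B c \<longleftrightarrow>
    (case c of (U, \<phi>) \<Rightarrow>
       openin (top_of_set M) U \<and> \<phi> \<in> extensional U \<and>
       (\<exists>V \<psi>. openin (top_of_set half_plane) V \<and> homeomorphism U V \<phi> \<psi>) \<and>
       (\<forall>p\<in>U. p \<in> B \<longleftrightarrow> \<phi> p \<in> UNIV \<times> {0}))"

definition foliated_change :: "'a chart \<Rightarrow> 'a chart \<Rightarrow> bool" where
  "foliated_change c d \<longleftrightarrow>
    (case (c, d) of ((U, \<phi>), (V, \<psi>)) \<Rightarrow>
       \<exists>(g :: real \<times> real \<Rightarrow> real) (h :: real \<Rightarrow> real).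
         continuous_on (\<phi> ` (U \<inter> V)) g \<and> continuous_on (snd ` \<phi> ` (U \<inter> V)) h \<and>
         (\<forall>(x, y) \<in> \<phi> ` (U \<inter> V). \<psi> (the_inv_into U \<phi> (x, y)) = (g (x, y), h y)))"

definition foliated_atlas ::
  "'a::topological_space set \<Rightarrow> 'a set \<Rightarrow> 'a chart set \<Rightarrow> bool" where
  "foliated_atlas M B A \<longleftrightarrow>
     (\<forall>c\<in>A. boundary_chart M B c) \<and> (\<Union>c\<in>A. fst c) = M \<and>
     (\<forall>c\<in>A. \<forall>d\<in>A. foliated_change c d)"

definition foliation_tangent_to_boundary ::
  "'a::topological_space set \<Rightarrow> 'a set \<Rightarrow> 'a chart set \<Rightarrow> bool" where
  "foliation_tangent_to_boundary M B A \<longleftrightarrow>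
     foliated_atlas M B A \<and> (\<forall>A'. foliated_atlas M B A' \<longrightarrow> A \<subseteq> A' \<longrightarrow> A' = A)"

end

theory Submission
  imports Defs
begin

text \<open>
  In the rectangular quadrant the level sets of \<open>min x y\<close> are copies of the long line and form the
  required foliation.

  In the rhombic quadrant, every chart around a diagonal point \<open>(t, t)\<close> contains a triangle
  \<open>{a < x \<le> y \<le> t}\<close> with \<open>a < t\<close>, and by pressing down a single \<open>a\<close> works for unboundedly many \<open>t\<close>.
  Since transverse coordinates change by functions of themselves, their level sets fit together to
  closed leaves of \<open>{a < x}\<close>. A leaf that misses the diagonal has bounded first coordinate, because
  an unbounded closed set meets the diagonal. Countably many leaves accumulating at one diagonal
  point accumulate at all later ones, although their first coordinates have a common bound.

  A homeomorphism \<open>h\<close> between the quadrants sends at most one horizontal line to a line with first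
  coordinate unbounded above, since two such lines would both meet the diagonal at a common
  parameter. Hence the preimages of both boundary rays are unbounded in both coordinates, and a common
  fixed point gives \<open>h (\<alpha>, \<alpha>) = (\<alpha>, \<alpha>) = (-\<alpha>, \<alpha>)\<close> with \<open>\<alpha> > 0\<close>.
\<close>

section \<open>Order and topology of the long ray\<close>

abbreviation ordinal_part :: "long_ray \<Rightarrow> omega1" where
  "ordinal_part x \<equiv> fst (Rep_long_ray x)"

abbreviation real_part :: "long_ray \<Rightarrow> real" where
  "real_part x \<equiv> snd (Rep_long_ray x)"

lemma real_part_bounds: "0 \<le> real_part x" "real_part x < 1"
  using Rep_long_ray[of x] by auto

lemma Rep_Abs_long_ray:
  assumes "0 \<le> r" "r < 1"
  shows "Rep_long_ray (Abs_long_ray (\<alpha>, r)) = (\<alpha>, r)"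
  using assms by (simp add: Abs_long_ray_inverse)

lemma less_long_ray_iff:
  "x < y \<longleftrightarrow> ordinal_part x < ordinal_part y \<or>
     ordinal_part x = ordinal_part y \<and> real_part x < real_part y"
  by (auto simp: less_long_ray_def less_eq_long_ray_def)

text \<open>The closed initial segments below the elements of \<open>A\<close> are countable, so
  their countable union cannot exhaust an uncountable type; any point outside it lies above
  \<open>A\<close>.\<close>

lemma countable_bounded_omega1:
  fixes A :: "omega1 set"
  assumes "countable A"
  shows "\<exists>\<beta>. \<forall>\<alpha>\<in>A. \<alpha> < \<beta>"
proof -
  have "countable (\<Union>\<alpha>\<in>A. {..<\<alpha>} \<union> {\<alpha>})"
    using assms countable_lessThan_omega1 by (intro countable_UN countable_Un) auto
  then obtain \<beta> where "\<beta> \<notin> (\<Union>\<alpha>\<in>A. {..<\<alpha>} \<union> {\<alpha>})"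
    using uncountable_omega1 by (metis UNIV_eq_I)
  then show ?thesis by (intro exI[of _ \<beta>]) (auto simp: not_less le_less)
qed

lemma countable_bounded_long_ray:
  fixes A :: "long_ray set"
  assumes "countable A"
  shows "\<exists>b. \<forall>x\<in>A. x < b"
proof -
  obtain \<beta> where "\<forall>\<alpha>\<in>ordinal_part ` A. \<alpha> < \<beta>"
    using countable_bounded_omega1[of "ordinal_part ` A"] assms by blast
  then show ?thesis
    by (intro exI[of _ "Abs_long_ray (\<beta>, 0)"]) (auto simp: less_long_ray_iff Rep_Abs_long_ray)
qed

section \<open>Order completeness and increasing sequences\<close>

instantiation long_ray :: conditionally_complete_linorder
begin

definition inf_long_ray :: "long_ray \<Rightarrow> long_ray \<Rightarrow> long_ray" where
  "inf_long_ray = min"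

definition sup_long_ray :: "long_ray \<Rightarrow> long_ray \<Rightarrow> long_ray" where
  "sup_long_ray = max"

text \<open>The least ordinal part is attained, so the real infimum inside that segment is over a
  nonempty set and stays in \<open>[0, 1)\<close>.\<close>

definition Inf_long_ray :: "long_ray set \<Rightarrow> long_ray" where
  "Inf_long_ray S = (let \<alpha> = (LEAST \<alpha>. \<alpha> \<in> ordinal_part ` S)
            in Abs_long_ray (\<alpha>, Inf (real_part ` {x\<in>S. ordinal_part x = \<alpha>})))"

text \<open>Real suprema inside a segment may equal 1 and leave it, hence the detour through upper
  bounds.\<close>

definition Sup_long_ray :: "long_ray set \<Rightarrow> long_ray" where
  "Sup_long_ray S = Inf {u. \<forall>x\<in>S. x \<le> u}"

instance
proof
  fix x y z :: long_ray and S :: "long_ray set"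
  show "inf x y \<le> x" "inf x y \<le> y" "x \<le> y \<Longrightarrow> x \<le> z \<Longrightarrow> x \<le> inf y z"
    "x \<le> sup x y" "y \<le> sup x y" "y \<le> x \<Longrightarrow> z \<le> x \<Longrightarrow> sup y z \<le> x"
    by (auto simp: inf_long_ray_def sup_long_ray_def)
  have Inf_glb: "(\<forall>x\<in>S. Inf S \<le> x) \<and> (\<forall>z. (\<forall>x\<in>S. z \<le> x) \<longrightarrow> z \<le> Inf S)"
    if "S \<noteq> {}" for S :: "long_ray set"
  proof -
    define \<alpha> where "\<alpha> = (LEAST \<alpha>. \<alpha> \<in> ordinal_part ` S)"
    define R where "R = real_part ` {x\<in>S. ordinal_part x = \<alpha>}"
    have "\<alpha> \<in> ordinal_part ` S"
      unfolding \<alpha>_def using that by (metis LeastI ex_in_conv image_is_empty)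
    then obtain x0 where x0: "x0 \<in> S" "ordinal_part x0 = \<alpha>" by auto
    have least: "\<alpha> \<le> ordinal_part x" if "x \<in> S" for x
      unfolding \<alpha>_def using that by (intro Least_le) auto
    have bdd: "bdd_below R"
      unfolding R_def by (rule bdd_belowI[of _ 0]) (auto simp: real_part_bounds)
    have R: "real_part x0 \<in> R" using x0 by (auto simp: R_def)
    have "0 \<le> Inf R"
      using R by (intro cInf_greatest) (auto simp: R_def real_part_bounds)
    moreover have "Inf R < 1"
      using cInf_lower[OF R bdd] real_part_bounds[of x0] by linarith
    ultimately have Rep: "Rep_long_ray (Inf S) = (\<alpha>, Inf R)"
      by (simp add: Inf_long_ray_def Let_def \<alpha>_def[symmetric] R_def[symmetric] Rep_Abs_long_ray)
    show ?thesis
    proof (intro conjI ballI allI impI)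
      fix x assume x: "x \<in> S"
      have "Inf R \<le> real_part x" if "ordinal_part x = \<alpha>"
        using x that by (intro cInf_lower[OF _ bdd]) (auto simp: R_def)
      with least[OF x] show "Inf S \<le> x"
        unfolding less_eq_long_ray_def Rep by (metis fst_conv snd_conv order_le_less)
    next
      fix z assume z: "\<forall>x\<in>S. z \<le> x"
      then have "z \<le> x0" using x0 by auto
      moreover have "real_part z \<le> Inf R" if "ordinal_part z = \<alpha>"
      proof (rule cInf_greatest)
        show "R \<noteq> {}" using R by blast
        show "real_part z \<le> r" if r: "r \<in> R" for r
        proof -
          obtain x where "x \<in> S" "ordinal_part x = \<alpha>" "r = real_part x"
            using r unfolding R_def by blast
          with z \<open>ordinal_part z = \<alpha>\<close> show ?thesis
            by (metis less_eq_long_ray_def less_irrefl)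
        qed
      qed
      ultimately show "z \<le> Inf S"
        unfolding less_eq_long_ray_def Rep by (metis fst_conv snd_conv x0(2))
    qed
  qed
  show "x \<in> S \<Longrightarrow> bdd_below S \<Longrightarrow> Inf S \<le> x"
    using Inf_glb[of S] by auto
  show "S \<noteq> {} \<Longrightarrow> (\<And>x. x \<in> S \<Longrightarrow> z \<le> x) \<Longrightarrow> z \<le> Inf S"
    using Inf_glb[of S] by auto
  show "x \<le> Sup S" if "x \<in> S" "bdd_above S"
  proof -
    have "{u. \<forall>x\<in>S. x \<le> u} \<noteq> {}" using that by (auto simp: bdd_above_def)
    from Inf_glb[OF this] that(1) show ?thesis unfolding Sup_long_ray_def by blast
  qed
  show "S \<noteq> {} \<Longrightarrow> (\<And>x. x \<in> S \<Longrightarrow> x \<le> z) \<Longrightarrow> Sup S \<le> z"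
    using Inf_glb[of "{u. \<forall>x\<in>S. x \<le> u}"] unfolding Sup_long_ray_def by blast
qed

end

text \<open>There is always room to the right of \<open>x\<close> within its own segment. Rational
  real parts make the dense sets built from such points countable.\<close>

lemma long_ray_between_same_ordinal:
  fixes x y :: long_ray
  assumes "x < y"
  shows "\<exists>q\<in>\<rat>. real_part x < q \<and> q < 1 \<and> x < Abs_long_ray (ordinal_part x, q) \<and>
    Abs_long_ray (ordinal_part x, q) < y"
proof -
  define s where "s = (if ordinal_part x = ordinal_part y then real_part y else 1)"
  have s: "real_part x < s" "s \<le> 1"
    using assms real_part_bounds[of x] real_part_bounds[of y]
    by (auto simp: s_def less_long_ray_iff)
  then obtain q where q: "q \<in> \<rat>" "real_part x < q" "q < s"
    using Rats_dense_in_real by blast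
  then have "Rep_long_ray (Abs_long_ray (ordinal_part x, q)) = (ordinal_part x, q)"
    using s real_part_bounds[of x] by (intro Rep_Abs_long_ray) auto
  with q s assms show ?thesis
    by (intro bexI[of _ q]) (auto simp: less_long_ray_iff s_def split: if_splits)
qed

instance long_ray :: linear_continuum_topology
proof
  show "\<exists>z. x < z \<and> z < y" if "x < y" for x y :: long_ray
    using long_ray_between_same_ordinal[OF that] by blast
  show "\<exists>a b::long_ray. a \<noteq> b"
    using countable_bounded_long_ray[of "{0 :: long_ray}"] by (metis countable_insert countable_empty insertI1 less_irrefl)
qed

instance long_ray :: no_top
proof
  show "\<exists>y. x < y" for x :: long_ray
    using countable_bounded_long_ray[of "{x}"] by auto
qed

text \<open>A sequence has countable range, hence an upper bound and a supremum, which a strictly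
  increasing sequence never attains. All closing-off arguments below rest on this.\<close>

lemma incseq_tendsto_long_ray:
  fixes s :: "nat \<Rightarrow> long_ray"
  assumes "\<And>n. s n < s (Suc n)"
  obtains l where "s \<longlonglongrightarrow> l" "\<And>n. s n < l"
proof -
  have inc: "incseq s" using assms by (intro incseq_SucI) (simp add: less_imp_le)
  obtain b where "\<forall>x\<in>range s. x < b"
    using countable_bounded_long_ray[of "range s"] by auto
  then have bdd: "bdd_above (range s)" by (auto intro!: bdd_aboveI[of _ b] less_imp_le)
  have "s n < (SUP k. s k)" for n
    using less_le_trans[OF assms cSUP_upper[OF _ bdd]] by simp
  then show ?thesis using that LIMSEQ_incseq_SUP[OF bdd inc] by blast
qed

section \<open>Real coordinates on initial segments\<close>

lemma continuous_on_orderI: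
  fixes f :: "'a::topological_space \<Rightarrow> 'b::linorder_topology"
  assumes "\<And>b. open {x. f x < b}" "\<And>b. open {x. b < f x}"
  shows "continuous_on UNIV f"
proof (rule continuous_on_def[THEN iffD2], intro ballI order_tendstoI)
  fix x b
  show "\<forall>\<^sub>F y in at x. b < f y" if "b < f x"
    using assms(2)[of b] that unfolding eventually_at_topological by blast
  show "\<forall>\<^sub>F y in at x. f y < b" if "f x < b"
    using assms(1)[of b] that unfolding eventually_at_topological by blast
qed

text \<open>
  The function \<open>segment_coord \<alpha>\<close> rises from 0 to 1 across the \<open>\<alpha>\<close>-th unit segment of the long ray. Since
  only countably many of them vary below a given point, a summable combination embeds an initial
  segment into the reals.
\<close>

definition segment_coord :: "omega1 \<Rightarrow> long_ray \<Rightarrow> real" where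
  "segment_coord \<alpha> x =
     (if ordinal_part x < \<alpha> then 0 else if ordinal_part x = \<alpha> then real_part x else 1)"

lemma segment_coord_bounds: "0 \<le> segment_coord \<alpha> x" "segment_coord \<alpha> x \<le> 1"
  using real_part_bounds[of x] by (auto simp: segment_coord_def)

lemma segment_coord_mono: "x \<le> y \<Longrightarrow> segment_coord \<alpha> x \<le> segment_coord \<alpha> y"
  using real_part_bounds[of x] real_part_bounds[of y]
  by (auto simp: segment_coord_def less_eq_long_ray_def)

lemma segment_coord_strict:
  "x < y \<Longrightarrow> segment_coord (ordinal_part x) x < segment_coord (ordinal_part x) y"
  using real_part_bounds[of x] by (auto simp: segment_coord_def less_long_ray_iff)

lemma segment_coord_zero: "segment_coord \<alpha> 0 = 0"
proof -
  have "(LEAST a. True) \<le> \<alpha>" by (rule Least_le) simp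
  then show ?thesis by (auto simp: segment_coord_def zero_long_ray_def Rep_Abs_long_ray)
qed

lemma continuous_segment_coord: "continuous_on UNIV (segment_coord \<alpha>)"
proof -
  have gt: "open {x. r < segment_coord \<alpha> x}" for r
  proof -
    consider "r < 0" | "0 \<le> r" "r < 1" | "1 \<le> r" by linarith
    then show ?thesis
    proof cases
      case 1
      then have "{x. r < segment_coord \<alpha> x} = UNIV"
        using segment_coord_bounds(1)[of \<alpha>] by (auto intro: less_le_trans)
      then show ?thesis by simp
    next
      case 2
      then have "{x. r < segment_coord \<alpha> x} = {Abs_long_ray (\<alpha>, r)<..}"
        by (auto simp: segment_coord_def less_long_ray_iff Rep_Abs_long_ray split: if_splits)
      then show ?thesis by simp
    next
      case 3
      then have "{x. r < segment_coord \<alpha> x} = {}"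
        using segment_coord_bounds(2)[of \<alpha>] by (auto simp: not_less intro: order_trans)
      then show ?thesis by simp
    qed
  qed
  have lt: "open {x. segment_coord \<alpha> x < r}" for r
  proof (cases "1 < r")
    case True
    then have "{x. segment_coord \<alpha> x < r} = UNIV"
      using segment_coord_bounds(2)[of \<alpha>] by (auto intro: le_less_trans)
    then show ?thesis by simp
  next
    case False
    \<comment> \<open>A union over \<open>s < r\<close> also covers \<open>r = 1\<close>, where the
      segment has no endpoint \<open>(\<alpha>, 1)\<close>.\<close>
    have "{x. segment_coord \<alpha> x < r} = (\<Union>s\<in>{0..<r}. {..<Abs_long_ray (\<alpha>, s)})"
    proof (intro equalityI subsetI)
      fix x assume x: "x \<in> {x. segment_coord \<alpha> x < r}"
      then obtain s where s: "segment_coord \<alpha> x < s" "s < r" using dense by auto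
      then have "0 \<le> s" "s < 1" using segment_coord_bounds(1)[of \<alpha> x] False by auto
      with s have "x < Abs_long_ray (\<alpha>, s)"
        by (auto simp: segment_coord_def less_long_ray_iff Rep_Abs_long_ray split: if_splits)
      with s \<open>0 \<le> s\<close> show "x \<in> (\<Union>s\<in>{0..<r}. {..<Abs_long_ray (\<alpha>, s)})" by auto
    next
      fix x assume "x \<in> (\<Union>s\<in>{0..<r}. {..<Abs_long_ray (\<alpha>, s)})"
      then show "x \<in> {x. segment_coord \<alpha> x < r}"
        using False by (auto simp: segment_coord_def less_long_ray_iff Rep_Abs_long_ray split: if_splits)
    qed
    then show ?thesis by auto
  qed
  from lt gt show ?thesis by (rule continuous_on_orderI)
qed

lemma long_ray_segment_embedding:
  fixes b :: long_ray
  obtains f :: "long_ray \<Rightarrow> real" where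
    "continuous_on UNIV f" "strict_mono_on {..b} f" "f 0 = 0"
proof -
  define A where "A = insert (ordinal_part b) {..<ordinal_part b}"
  have A: "countable A" "A \<noteq> {}" using countable_lessThan_omega1 by (auto simp: A_def)
  \<comment> \<open>If \<open>A\<close> is finite the enumeration repeats elements, but strictness
    needs only one index for each ordinal in \<open>A\<close>.\<close>
  define w where "w n x = (1/2)^n * segment_coord (from_nat_into A n) x" for n :: nat and x
  define f where "f x = (\<Sum>n. w n x)" for x
  have w_bound: "norm (w n x) \<le> (1/2)^n" for n x
    using segment_coord_bounds[of "from_nat_into A n" x] by (simp add: w_def mult_le_cancel_left1)
  have geo: "summable (\<lambda>n. (1/2 :: real)^n)" by (simp add: summable_geometric)
  have summ: "summable (\<lambda>n. w n x)" for x
    using w_bound by (intro summable_comparison_test'[OF geo]) auto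
  have "uniform_limit UNIV (\<lambda>n x. \<Sum>i<n. w i x) f sequentially"
    unfolding f_def using w_bound geo by (intro Weierstrass_m_test) auto
  moreover have "continuous_on UNIV (w i)" for i
    unfolding w_def by (intro continuous_intros continuous_segment_coord)
  ultimately have "continuous_on UNIV f"
    by (intro uniform_limit_theorem[of _ "\<lambda>n x. \<Sum>i<n. w i x" sequentially])
       (auto intro!: always_eventually continuous_on_sum)
  moreover have "strict_mono_on {..b} f"
  proof (rule strict_mono_onI)
    fix x y assume xy: "x \<in> {..b}" "y \<in> {..b}" "x < y"
    have "ordinal_part x \<in> A"
      using xy(1) by (auto simp: A_def less_eq_long_ray_def)
    then obtain n where n: "from_nat_into A n = ordinal_part x"
      using A from_nat_into_surj by metis
    have "0 < (\<Sum>n. w n y - w n x)"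
    proof (rule suminf_pos2)
      show "summable (\<lambda>n. w n y - w n x)" by (intro summable_diff summ)
      show "0 \<le> w n y - w n x" for n
        using segment_coord_mono[of x y] xy by (simp add: w_def)
      show "0 < w n y - w n x"
        using segment_coord_strict[OF xy(3)] by (simp add: w_def n)
    qed
    then show "f x < f y" by (simp add: f_def suminf_diff[OF summ summ, symmetric])
  qed
  moreover have "f 0 = 0" by (simp add: f_def w_def segment_coord_zero)
  ultimately show ?thesis using that by blast
qed

text \<open>The embedding maps onto a half-open interval by the intermediate value theorem, and its
  inverse is monotone with open image, hence continuous. The order equivalence is recorded because
  the charts below use \<open>min\<close>.\<close>

lemma long_ray_segment_homeomorphism:
  fixes b :: long_ray
  obtains f g and c :: real where
    "homeomorphism {..<b} {0..<c} f g"
    "\<And>x y. x < b \<Longrightarrow> y < b \<Longrightarrow> f x \<le> f y \<longleftrightarrow> x \<le> y"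
proof -
  obtain f :: "long_ray \<Rightarrow> real" where
    f: "continuous_on UNIV f" "strict_mono_on {..b} f" "f 0 = 0"
    by (rule long_ray_segment_embedding)
  define g where "g = the_inv_into {..<b} f"
  have le: "f x \<le> f y \<longleftrightarrow> x \<le> y" if "x \<le> b" "y \<le> b" for x y
    using strict_mono_on_leD[OF f(2), of x y] strict_mono_onD[OF f(2), of y x] that
    by (auto simp: not_le[symmetric])
  have inj: "inj_on f {..<b}"
    using le by (intro inj_onI) (metis antisym lessThan_iff less_imp_le order_refl)
  have img: "f ` {..<b} = {0..<f b}"
  proof (intro equalityI subsetI)
    fix r assume "r \<in> f ` {..<b}"
    then obtain x where "r = f x" "x < b" by blast
    then show "r \<in> {0..<f b}"
      using le[of 0 x] le[of b x] f(3) zero_le_long_ray by (auto simp: not_le[symmetric])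
  next
    fix r assume r: "r \<in> {0..<f b}"
    have "continuous_on {0..b} f" using f(1) continuous_on_subset by blast
    then obtain x where "0 \<le> x" "x \<le> b" "f x = r"
      using IVT'[of f 0 r b] r f(3) zero_le_long_ray[of b] by auto
    with r show "r \<in> f ` {..<b}" by (intro image_eqI[of _ _ x]) (auto simp: less_le)
  qed
  have gf: "g (f x) = x" if "x < b" for x
    using the_inv_into_f_f[OF inj] that by (simp add: g_def)
  have fg: "f (g r) = r" "g r < b" if r: "r \<in> {0..<f b}" for r
  proof -
    obtain x where "x < b" "r = f x" using r img by blast
    then show "f (g r) = r" "g r < b" using gf by auto
  qed
  have gimg: "g ` {0..<f b} = {..<b}"
    using gf by (auto simp: img[symmetric] image_image)
  have "continuous_on {0..<f b} g"
  proof (rule continuous_onI_mono)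
    show "open (g ` {0..<f b})" by (simp add: gimg)
    show "g r \<le> g s" if "r \<in> {0..<f b}" "s \<in> {0..<f b}" "r \<le> s" for r s
      using that fg[of r] fg[of s] le[of "g r" "g s"] by auto
  qed
  then have "homeomorphism {..<b} {0..<f b} f g"
    using f(1) img gimg gf fg by (auto simp: homeomorphism_def intro: continuous_on_subset)
  then show ?thesis using that le by (meson less_imp_le)
qed

text \<open>Only countably many segments start at or below \<open>c\<close>, and each contributes
  its rational points. The freedom to omit \<open>e\<close> later serves to avoid one exceptional
  horizontal line.\<close>

lemma long_ray_countable_dense:
  fixes c e :: long_ray
  obtains D where "countable D" "e \<notin> D"
    "\<And>x y. x \<le> c \<Longrightarrow> x < y \<Longrightarrow> \<exists>d\<in>D. x < d \<and> d < y"
proof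
  define A where "A = insert (ordinal_part c) {..<ordinal_part c}"
  define D where "D = Abs_long_ray ` (A \<times> \<rat>)"
  show "countable (D - {e})"
    using countable_lessThan_omega1 countable_rat by (auto simp: D_def A_def)
  show "e \<notin> D - {e}" by simp
  fix x y :: long_ray assume x: "x \<le> c" "x < y"
  \<comment> \<open>Shortening the interval to end at \<open>e\<close> keeps the rational point
    found in it different from \<open>e\<close>.\<close>
  define y' where "y' = (if x < e then min e y else y)"
  have "x < y'" using x by (simp add: y'_def)
  then obtain q where q: "q \<in> \<rat>" "x < Abs_long_ray (ordinal_part x, q)"
    "Abs_long_ray (ordinal_part x, q) < y'"
    using long_ray_between_same_ordinal by blast
  moreover have "ordinal_part x \<in> A" using x(1) by (auto simp: A_def less_eq_long_ray_def)
  ultimately show "\<exists>d\<in>D - {e}. x < d \<and> d < y"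
    by (intro bexI[of _ "Abs_long_ray (ordinal_part x, q)"]) (auto simp: D_def y'_def split: if_splits)
qed

section \<open>A foliation of the rectangular quadrant\<close>

text \<open>Zorn's lemma: any two charts from the union of a chain already lie in one member, so
  their coordinate change is foliated.\<close>

lemma foliated_atlas_imp_foliation:
  assumes "foliated_atlas M B A"
  shows "\<exists>A. foliation_tangent_to_boundary M B A"
proof -
  have "\<exists>A\<in>Collect (foliated_atlas M B). \<forall>A'\<in>Collect (foliated_atlas M B). A \<subseteq> A' \<longrightarrow> A' = A"
  proof (rule subset_Zorn_nonempty)
    show "Collect (foliated_atlas M B) \<noteq> {}" using assms by blast
    fix \<C> assume \<C>: "\<C> \<noteq> {}" "subset.chain (Collect (foliated_atlas M B)) \<C>"
    then have atlas: "foliated_atlas M B A" if "A \<in> \<C>" for A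
      using that by (auto simp: subset.chain_def)
    have "foliated_change c d" if "c \<in> A" "A \<in> \<C>" "d \<in> A'" "A' \<in> \<C>" for c d A A'
    proof -
      have "A \<subseteq> A' \<or> A' \<subseteq> A" using \<C>(2) that by (auto simp: subset.chain_def)
      then obtain D where "D \<in> \<C>" "c \<in> D" "d \<in> D"
        using \<open>c \<in> A\<close> \<open>A \<in> \<C>\<close> \<open>d \<in> A'\<close> \<open>A' \<in> \<C>\<close> by blast
      then show ?thesis using atlas[of D] by (simp add: foliated_atlas_def)
    qed
    moreover have "boundary_chart M B c" if "c \<in> \<Union>\<C>" for c
      using atlas that by (auto simp: foliated_atlas_def)
    moreover have "(\<Union>c\<in>\<Union>\<C>. fst c) = M"
    proof -
      have "(\<Union>c\<in>\<Union>\<C>. fst c) = (\<Union>A\<in>\<C>. \<Union>c\<in>A. fst c)" by blast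
      also have "\<dots> = (\<Union>A\<in>\<C>. M)" using atlas by (intro SUP_cong) (auto simp: foliated_atlas_def)
      finally show ?thesis using \<C>(1) by auto
    qed
    ultimately show "\<Union>\<C> \<in> Collect (foliated_atlas M B)"
      unfolding foliated_atlas_def by auto
  qed
  then show ?thesis unfolding foliation_tangent_to_boundary_def by blast
qed

lemma rect_quadrant_foliated_atlas: "\<exists>A. foliated_atlas rect_quadrant rect_boundary A"
proof -
  have "\<exists>f g c. homeomorphism {..<b} {0..<c :: real} f g \<and>
      (\<forall>x y. x < b \<longrightarrow> y < b \<longrightarrow> (f x \<le> f y \<longleftrightarrow> x \<le> y))" for b :: long_ray
    by (rule long_ray_segment_homeomorphism[of b]) blast
  then obtain F :: "long_ray \<Rightarrow> long_ray \<Rightarrow> real" and G C where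
    homeo: "homeomorphism {..<b} {0..<C b} (F b) (G b)" and
    le: "x < b \<Longrightarrow> y < b \<Longrightarrow> F b x \<le> F b y \<longleftrightarrow> x \<le> y" for b x y
    by metis
  have contF: "continuous_on {..<b} (F b)" and contG: "continuous_on {0..<C b} (G b)" for b
    using homeo[of b] by (auto simp: homeomorphism_def)
  have F: "0 \<le> F b x" "F b x < C b" and GF: "G b (F b x) = x" if "x < b" for b x
    using homeo[of b] that by (auto simp: homeomorphism_def)
  have G: "G b r < b" and FG: "F b (G b r) = r" if "0 \<le> r" "r < C b" for b r
    using homeo[of b] that by (auto simp: homeomorphism_def)
  have F_eq_0: "F b x = 0 \<longleftrightarrow> x = 0" if "x < b" for b x
  proof -
    define z where "z = G b 0"
    have "z < b" "F b z = 0" using F[OF that] G[of 0 b] FG[of 0 b] by (auto simp: z_def)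
    moreover have "F b 0 \<le> F b z"
      using le[of 0 b z] \<open>z < b\<close> zero_le_long_ray[of z] by (auto intro: le_less_trans)
    moreover have "0 < b" using zero_le_long_ray[of x] that by (rule le_less_trans)
    ultimately have "F b 0 = 0" using F[of 0 b] by auto
    then show ?thesis using GF[OF that] GF[OF \<open>0 < b\<close>] by metis
  qed
  define U where "U b = {..<b} \<times> {..<b}" for b :: long_ray
  \<comment> \<open>The difference runs along a level set of the minimum and \<open>min\<close> is
    the transverse coordinate; this flattens the corner at the origin onto the boundary
    line.\<close>
  define \<Phi> where "\<Phi> b p = (F b (fst p) - F b (snd p), min (F b (fst p)) (F b (snd p)))" for b p
  define \<phi> where "\<phi> b = restrict (\<Phi> b) (U b)" for b
  \<comment> \<open>For \<open>q = \<Phi> b p\<close> the sum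
    \<open>snd q + \<bar>fst q\<bar>\<close> is the larger of the two real coordinates.\<close>
  define V where "V b = half_plane \<inter> {q. snd q + \<bar>fst q\<bar> < C b}" for b
  define \<psi> where "\<psi> b q = (G b (snd q + max (fst q) 0), G b (snd q + max (- fst q) 0))" for b q
  have \<phi>_eq: "\<phi> b p = \<Phi> b p" if "p \<in> U b" for b p using that by (simp add: \<phi>_def)
  have cont\<Phi>: "continuous_on (U b) (\<Phi> b)" for b
    unfolding \<Phi>_def U_def
    by (intro continuous_intros continuous_on_compose2[OF contF]) auto
  have cont\<psi>: "continuous_on (V b) (\<psi> b)" for b
    unfolding \<psi>_def
    by (intro continuous_intros continuous_on_compose2[OF contG]) (auto simp: V_def half_plane_def)
  have \<Phi>V: "\<Phi> b p \<in> V b" if "p \<in> U b" for b p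
    using that F[of "fst p" b] F[of "snd p" b] by (auto simp: U_def \<Phi>_def V_def half_plane_def)
  have \<psi>U: "\<psi> b q \<in> U b" if "q \<in> V b" for b q
    using that by (auto simp: U_def \<psi>_def V_def half_plane_def intro!: G)
  have \<psi>\<Phi>: "\<psi> b (\<Phi> b p) = p" if "p \<in> U b" for b p
  proof -
    have "min s t + max (s - t) 0 = s" "min s t + max (- (s - t)) 0 = t" for s t :: real by auto
    then show ?thesis using that GF by (simp add: U_def \<psi>_def \<Phi>_def mem_Times_iff)
  qed
  have \<Phi>\<psi>: "\<Phi> b (\<psi> b q) = q" if "q \<in> V b" for b q
  proof -
    have "F b (G b (snd q + max (fst q) 0)) = snd q + max (fst q) 0"
      "F b (G b (snd q + max (- fst q) 0)) = snd q + max (- fst q) 0"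
      using that by (auto simp: V_def half_plane_def intro!: FG)
    then show ?thesis by (auto simp: \<Phi>_def \<psi>_def prod_eq_iff)
  qed
  have homeo\<phi>: "homeomorphism (U b) (V b) (\<phi> b) (\<psi> b)" for b
    unfolding homeomorphism_def
    using \<phi>_eq[of _ b] cont\<Phi>[of b] cont\<psi>[of b] \<Phi>V[of _ b] \<psi>U[of _ b] \<psi>\<Phi>[of _ b] \<Phi>\<psi>[of _ b]
    by (auto cong: continuous_on_cong) (metis image_eqI)+
  have "boundary_chart rect_quadrant rect_boundary (U b, \<phi> b)" for b
  proof -
    have "open {q :: real \<times> real. snd q + \<bar>fst q\<bar> < C b}"
      by (intro open_Collect_less continuous_intros)
    then have "openin (top_of_set half_plane) (V b)" by (auto simp: V_def openin_open)
    moreover have "p \<in> rect_boundary \<longleftrightarrow> \<phi> b p \<in> UNIV \<times> {0}" if "p \<in> U b" for p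
    proof -
      have p: "fst p < b" "snd p < b" using that by (auto simp: U_def)
      have "p \<in> rect_boundary \<longleftrightarrow> fst p = 0 \<or> snd p = 0"
        by (auto simp: rect_boundary_def mem_Times_iff)
      also have "\<dots> \<longleftrightarrow> min (F b (fst p)) (F b (snd p)) = 0"
        using F[OF p(1)] F[OF p(2)] F_eq_0[OF p(1)] F_eq_0[OF p(2)] by (auto simp: min_def)
      finally show ?thesis using that by (simp add: \<phi>_eq \<Phi>_def)
    qed
    moreover have "openin (top_of_set rect_quadrant) (U b)"
      by (auto simp: rect_quadrant_def U_def intro: open_Times)
    ultimately show ?thesis
      using homeo\<phi>[of b] unfolding boundary_chart_def \<phi>_def by auto
  qed
  moreover have "foliated_change (U b, \<phi> b) (U c, \<phi> c)" for b c
  proof -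
    have inv: "the_inv_into (U b) (\<phi> b) (\<phi> b p) = p" if "p \<in> U b" for p
      using that \<psi>\<Phi>[of _ b] \<phi>_eq[of _ b] by (intro the_inv_into_f_f inj_onI) (metis, simp)
    \<comment> \<open>The map \<open>F c\<close> after \<open>G b\<close> preserves order where both
      boxes overlap, so it commutes with \<open>min\<close>, and the new transverse coordinate
      depends on the old one alone.\<close>
    have change: "\<phi> c p = (fst (\<Phi> c (\<psi> b (\<phi> b p))), F c (G b (snd (\<phi> b p))))"
      if p: "p \<in> U b \<inter> U c" for p
    proof -
      have lt: "fst p < b" "snd p < b" "fst p < c" "snd p < c" using p by (auto simp: U_def)
      have "F c (G b (min (F b (fst p)) (F b (snd p)))) = min (F c (fst p)) (F c (snd p))"
        using lt le[OF lt(1,2)] le[OF lt(3,4)] GF by (auto simp: min_def)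
      with p show ?thesis by (simp add: \<phi>_eq \<psi>\<Phi>) (simp add: \<Phi>_def)
    qed
    have "continuous_on (\<phi> b ` (U b \<inter> U c)) (\<lambda>q. fst (\<Phi> c (\<psi> b q)))"
    proof (intro continuous_on_fst continuous_on_compose2[OF cont\<Phi>[of c]])
      show "continuous_on (\<phi> b ` (U b \<inter> U c)) (\<psi> b)"
        using \<phi>_eq \<Phi>V by (intro continuous_on_subset[OF cont\<psi>[of b]]) auto
      show "\<psi> b ` \<phi> b ` (U b \<inter> U c) \<subseteq> U c" using \<phi>_eq \<psi>\<Phi> by auto
    qed
    moreover have "continuous_on (snd ` \<phi> b ` (U b \<inter> U c)) (\<lambda>s. F c (G b s))"
    proof -
      have *: "\<exists>x. x < b \<and> x < c \<and> s = F b x" if "s \<in> snd ` \<phi> b ` (U b \<inter> U c)" for s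
        using that by (auto simp: \<phi>_eq \<Phi>_def U_def min_def)
      show ?thesis
      proof (rule continuous_on_compose2[OF contF[of c]])
        show "continuous_on (snd ` \<phi> b ` (U b \<inter> U c)) (G b)"
        proof (rule continuous_on_subset[OF contG[of b]], rule subsetI)
          show "s \<in> {0..<C b}" if "s \<in> snd ` \<phi> b ` (U b \<inter> U c)" for s
            using *[OF that] F by auto
        qed
        show "G b ` snd ` \<phi> b ` (U b \<inter> U c) \<subseteq> {..<c}"
          using * GF by (metis image_subsetI lessThan_iff)
      qed
    qed
    ultimately show ?thesis
      unfolding foliated_change_def using inv change
      by (auto intro!: exI[of _ "\<lambda>q. fst (\<Phi> c (\<psi> b q))"] exI[of _ "\<lambda>s. F c (G b s)"])
        (metis snd_conv)
  qed
  moreover have "(\<Union>b. U b) = rect_quadrant"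
  proof -
    have "\<exists>b. p \<in> U b" for p :: "long_ray \<times> long_ray"
      using gt_ex[of "max (fst p) (snd p)"] by (auto simp: U_def mem_Times_iff)
    then show ?thesis by (auto simp: rect_quadrant_def)
  qed
  ultimately have "foliated_atlas rect_quadrant rect_boundary (range (\<lambda>b. (U b, \<phi> b)))"
    by (auto simp: foliated_atlas_def)
  then show ?thesis by blast
qed

section \<open>The long line and the rhombic quadrant\<close>

definition pos_ray :: "long_ray \<Rightarrow> long_line" where
  "pos_ray a = Abs_long_line (Inr a)"

text \<open>A continuous retraction collapsing the negative half, so that limits and bounds can be
  handled in the long ray.\<close>

definition ray_part :: "long_line \<Rightarrow> long_ray" where
  "ray_part x = (case Rep_long_line x of Inl _ \<Rightarrow> 0 | Inr a \<Rightarrow> a)"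

lemma Rep_pos_ray: "Rep_long_line (pos_ray a) = Inr a"
  by (simp add: pos_ray_def Abs_long_line_inverse)

lemma pos_ray_cases:
  obtains a where "x = pos_ray a" | "x < pos_ray 0"
proof (cases "Rep_long_line x")
  case (Inl a)
  then show ?thesis using that by (auto simp: less_long_line_def less_eq_long_line_def Rep_pos_ray)
next
  case (Inr a)
  then show ?thesis using that by (metis Rep_pos_ray Rep_long_line_inject)
qed

lemma pos_ray_le_iff [simp]: "pos_ray a \<le> pos_ray b \<longleftrightarrow> a \<le> b"
  by (simp add: less_eq_long_line_def Rep_pos_ray)

lemma pos_ray_less_iff [simp]: "pos_ray a < pos_ray b \<longleftrightarrow> a < b"
  by (simp add: less_long_line_def less_le_not_le)

lemma ray_part_pos_ray [simp]: "ray_part (pos_ray a) = a"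
  by (simp add: ray_part_def Rep_pos_ray)

lemma ray_part_neg: "x < pos_ray 0 \<Longrightarrow> ray_part x = 0"
  using zero_le_long_ray
  by (auto simp: less_long_line_def less_eq_long_line_def Rep_pos_ray ray_part_def split: sum.splits)

lemma ray_part_le_iff: "ray_part x \<le> a \<longleftrightarrow> x \<le> pos_ray a"
proof (cases x rule: pos_ray_cases)
  case 2
  then have "x \<le> pos_ray a"
    using zero_le_long_ray[of a] by (meson less_imp_le order_trans pos_ray_le_iff)
  with 2 show ?thesis by (simp add: ray_part_neg zero_le_long_ray)
qed simp

lemma less_ray_part_iff: "a < ray_part x \<longleftrightarrow> pos_ray a < x"
  using ray_part_le_iff[of x a] by (auto simp: not_le[symmetric])

lemma ray_part_mono: "x \<le> y \<Longrightarrow> ray_part x \<le> ray_part y"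
  by (metis order_refl order_trans ray_part_le_iff)

lemma pos_ray_ray_part: "pos_ray 0 \<le> x \<Longrightarrow> pos_ray (ray_part x) = x"
  by (cases x rule: pos_ray_cases) (auto simp: not_less[symmetric])

text \<open>Only the value \<open>0\<close> is ambiguous, which is why later limits and fixed points
  are kept strictly positive.\<close>

lemma ray_part_eq_pos: "ray_part x = a \<Longrightarrow> 0 < a \<Longrightarrow> x = pos_ray a"
  by (cases x rule: pos_ray_cases) (auto simp: ray_part_neg)

lemma continuous_pos_ray: "continuous_on UNIV pos_ray"
proof (rule continuous_on_orderI)
  fix z
  show "open {a. pos_ray a < z}"
  proof (cases z rule: pos_ray_cases)
    case (1 b)
    then have "{a. pos_ray a < z} = {..<b}" by auto
    then show ?thesis by simp
  next
    case 2
    then have "{a. pos_ray a < z} = {}"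
      using zero_le_long_ray by (metis (mono_tags, lifting) Collect_empty_eq not_less order_trans
          pos_ray_le_iff less_imp_le)
    then show ?thesis by simp
  qed
  show "open {a. z < pos_ray a}"
  proof (cases z rule: pos_ray_cases)
    case (1 b)
    then have "{a. z < pos_ray a} = {b<..}" by auto
    then show ?thesis by simp
  next
    case 2
    then have "{a. z < pos_ray a} = UNIV"
      using zero_le_long_ray by (auto intro: less_le_trans)
    then show ?thesis by simp
  qed
qed

lemma continuous_ray_part: "continuous_on UNIV ray_part"
proof (rule continuous_on_orderI)
  fix b
  show "open {x. b < ray_part x}" by (simp add: less_ray_part_iff open_Collect_less)
  have "ray_part x < b \<longleftrightarrow> 0 < b \<and> x < pos_ray b" for x
  proof (cases x rule: pos_ray_cases)
    case (1 a)
    then show ?thesis using zero_le_long_ray[of a] by (auto intro: le_less_trans)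
  next
    case 2
    then show ?thesis by (auto simp: ray_part_neg intro: less_trans)
  qed
  then have "{x. ray_part x < b} = (if 0 < b then {..<pos_ray b} else {})" by auto
  then show "open {x. ray_part x < b}" by auto
qed

lemma continuous_uminus_long_line: "continuous_on UNIV (uminus :: long_line \<Rightarrow> long_line)"
proof (rule continuous_on_orderI)
  fix z :: long_line
  have "- x \<le> z \<longleftrightarrow> - z \<le> x" "z \<le> - x \<longleftrightarrow> x \<le> - z" for x
    using neg_le_neg_long_line[of "- z" x] neg_le_neg_long_line[of x "- z"]
    by (simp_all add: minus_minus_long_line)
  then have "{x. - x < z} = {- z<..}" "{x. z < - x} = {..<- z}" by (auto simp: not_le[symmetric])
  then show "open {x. - x < z}" "open {x. z < - x}" by simp_all
qed

lemma rhombic_nonneg: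
  assumes "p \<in> rhombic_quadrant"
  shows "pos_ray 0 \<le> snd p"
proof -
  have "- snd p \<le> snd p" using assms by (auto simp: rhombic_quadrant_def)
  then show ?thesis
    by (auto simp: less_eq_long_line_def Rep_pos_ray Rep_uminus_long_line zero_le_long_ray
        split: sum.splits if_splits)
qed

lemma rhombic_ray_part_le: "p \<in> rhombic_quadrant \<Longrightarrow> ray_part (fst p) \<le> ray_part (snd p)"
  by (auto simp: rhombic_quadrant_def intro: ray_part_mono)

lemma diagonal_mem_rhombic:
  "(pos_ray t, pos_ray t) \<in> rhombic_quadrant" "(- pos_ray t, pos_ray t) \<in> rhombic_quadrant"
  by (auto simp: rhombic_quadrant_def less_eq_long_line_def Rep_pos_ray Rep_uminus_long_line)

lemma diagonal_mem_boundary: "(pos_ray t, pos_ray t) \<in> rhombic_boundary"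
  using diagonal_mem_rhombic by (auto simp: rhombic_boundary_def)

lemma reflect_mem_rhombic: "(x, y) \<in> rhombic_quadrant \<Longrightarrow> (- x, y) \<in> rhombic_quadrant"
  using neg_le_neg_long_line[of y x] neg_le_neg_long_line[of x "- y"]
  by (auto simp: rhombic_quadrant_def minus_minus_long_line)

lemma tendsto_squeeze_Suc:
  fixes s w :: "nat \<Rightarrow> 'a::linorder_topology"
  assumes "s \<longlonglongrightarrow> l" "\<And>n. s n \<le> w n" "\<And>n. w n \<le> s (Suc n)"
  shows "w \<longlonglongrightarrow> l"
  using assms by (intro tendsto_sandwich[OF _ _ assms(1) LIMSEQ_Suc[OF assms(1)]]) auto

text \<open>
  Points of the rhombic quadrant can be interleaved so that each lies beyond both coordinates of its
  predecessor; hence a closed set on which the first coordinate is unbounded meets the diagonal.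
\<close>

lemma rhombic_unbounded_limit:
  assumes "K \<subseteq> rhombic_quadrant" and unbounded: "\<And>b. \<exists>q\<in>K. b < ray_part (fst q)"
  obtains q l where "q \<longlonglongrightarrow> (pos_ray l, pos_ray l)" "\<And>n :: nat. q n \<in> K"
    "\<And>n. b < ray_part (fst (q n))" "\<And>n. ray_part (snd (q n)) < l"
proof -
  obtain N where N: "N x \<in> K" "x < ray_part (fst (N x))" for x using unbounded by metis
  define q where "q = rec_nat (N b) (\<lambda>_ p. N (ray_part (snd p)))"
  have q_simps: "q 0 = N b" "q (Suc n) = N (ray_part (snd (q n)))" for n by (auto simp: q_def)
  have qK: "q n \<in> K" for n by (cases n) (auto simp: q_simps N)
  define s where "s n = ray_part (fst (q n))" for n
  define w where "w n = ray_part (snd (q n))" for n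
  have sw: "s n \<le> w n" for n
    using qK assms(1) by (auto simp: s_def w_def intro!: rhombic_ray_part_le)
  have ws: "w n < s (Suc n)" for n using N(2) by (simp add: s_def w_def q_simps)
  have step: "s n < s (Suc n)" for n using sw ws by (rule le_less_trans)
  then obtain l where l: "s \<longlonglongrightarrow> l" "\<And>n. s n < l" by (rule incseq_tendsto_long_ray) blast
  have wl: "w \<longlonglongrightarrow> l"
    using sw ws by (intro tendsto_squeeze_Suc[OF l(1)]) (auto intro: less_imp_le)
  have bs: "b < s n" for n
  proof (induction n)
    case 0 show ?case using N by (simp add: s_def q_simps)
  next
    case (Suc n) then show ?case using step[of n] by (rule less_trans)
  qed
  have "fst (q n) = pos_ray (s n)" for n
    using bs[of n] zero_le_long_ray[of b] by (intro ray_part_eq_pos) (auto simp: s_def)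
  moreover have "snd (q n) = pos_ray (w n)" for n
    using pos_ray_ray_part[OF rhombic_nonneg, of "q n"] qK[of n] assms(1) by (auto simp: w_def)
  ultimately have "q = (\<lambda>n. (pos_ray (s n), pos_ray (w n)))" by (auto simp: prod_eq_iff)
  moreover have "(\<lambda>n. pos_ray (s n)) \<longlonglongrightarrow> pos_ray l" "(\<lambda>n. pos_ray (w n)) \<longlonglongrightarrow> pos_ray l"
    using l(1) wl by (auto intro: continuous_on_tendsto_compose[OF continuous_pos_ray])
  ultimately have "q \<longlonglongrightarrow> (pos_ray l, pos_ray l)" by (auto intro: tendsto_Pair)
  moreover have "w n < l" for n using ws l(2) by (rule less_trans)
  ultimately show ?thesis using that qK bs by (auto simp: s_def w_def)
qed

section \<open>The rhombic quadrant has no foliation\<close>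

text \<open>Otherwise \<open>a t\<close> exceeds each \<open>c\<close> for all \<open>t\<close>
  beyond some \<open>g c\<close>. Iterating past \<open>g\<close> gives a limit \<open>l\<close>
  above every \<open>g (s n)\<close>, so \<open>a l\<close> exceeds every \<open>s n\<close>,
  against \<open>a l < l\<close>.\<close>

lemma pressing_down_long_ray:
  fixes a :: "long_ray \<Rightarrow> long_ray"
  assumes regressive: "\<And>t. 0 < t \<Longrightarrow> a t < t"
  obtains c where "\<And>b. \<exists>t>b. a t \<le> c"
proof (rule ccontr)
  assume "\<not> thesis"
  then have "\<forall>c. \<exists>b. \<forall>t>b. c < a t" using that by (meson not_le)
  then obtain g where g: "\<And>c t. g c < t \<Longrightarrow> c < a t" by metis
  have "\<exists>y. x < y \<and> g x < y" for x using gt_ex[of "max x (g x)"] by auto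
  then obtain N where N: "x < N x" "g x < N x" for x by metis
  define s where "s n = (N ^^ n) 0" for n
  have "s n < s (Suc n)" for n using N by (simp add: s_def)
  then obtain l where l: "s \<longlonglongrightarrow> l" "\<And>n. s n < l" by (rule incseq_tendsto_long_ray) blast
  have "0 < l" using l(2)[of 0] zero_le_long_ray[of "s 0"] by (auto intro: le_less_trans)
  then have "a l < l" by (rule regressive)
  then have "eventually (\<lambda>n. a l < s n) sequentially" using l(1) by (rule order_tendstoD(1)[rotated])
  then obtain n where n: "a l < s n" by (auto simp: eventually_sequentially)
  have "g (s n) < s (Suc n)" using N by (simp add: s_def)
  also have "s (Suc n) < l" by (rule l)
  finally have "s n < a l" by (rule g)
  with n show False by auto
qed

section \<open>Charts near a boundary point and their level sets\<close>

lemma boundary_chart_inj_on: "boundary_chart M B (U, \<phi>) \<Longrightarrow> inj_on \<phi> U"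
  unfolding boundary_chart_def homeomorphism_def by (auto intro: inj_on_inverseI)

lemma boundary_chart_continuous: "boundary_chart M B (U, \<phi>) \<Longrightarrow> continuous_on U \<phi>"
  unfolding boundary_chart_def homeomorphism_def by auto

lemma boundary_chart_subset: "boundary_chart M B (U, \<phi>) \<Longrightarrow> U \<subseteq> M"
  unfolding boundary_chart_def using openin_imp_subset by auto

lemma boundary_chart_snd_nonneg: "boundary_chart M B (U, \<phi>) \<Longrightarrow> p \<in> U \<Longrightarrow> 0 \<le> snd (\<phi> p)"
  unfolding boundary_chart_def homeomorphism_def
  by (auto dest!: openin_imp_subset simp: half_plane_def)

lemma boundary_chart_snd_eq_0:
  "boundary_chart M B (U, \<phi>) \<Longrightarrow> p \<in> U \<Longrightarrow> snd (\<phi> p) = 0 \<longleftrightarrow> p \<in> B"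
  unfolding boundary_chart_def by (auto simp: mem_Times_iff)

text \<open>The curve is the preimage of a short vertical segment over the image of
  \<open>p\<close>. It realises every small transverse level at points close to
  \<open>p\<close>.\<close>

lemma boundary_chart_transversal:
  assumes chart: "boundary_chart M B (U, \<phi>)" and p: "p \<in> U" "p \<in> B"
  obtains \<kappa> and \<delta> :: real where "0 < \<delta>" "continuous_on {0..<\<delta>} \<kappa>" "\<kappa> 0 = p"
    "\<And>r. r \<in> {0..<\<delta>} \<Longrightarrow> \<kappa> r \<in> U \<and> snd (\<phi> (\<kappa> r)) = r"
proof -
  obtain V \<psi> where V: "openin (top_of_set half_plane) V" and homeo: "homeomorphism U V \<phi> \<psi>"
    using chart by (auto simp: boundary_chart_def)
  define e where "e = fst (\<phi> p)"
  have \<phi>p: "\<phi> p = (e, 0)"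
    using boundary_chart_snd_eq_0[OF chart p(1)] p(2) by (auto simp: e_def prod_eq_iff)
  obtain W where W: "open W" "V = half_plane \<inter> W" using V by (auto simp: openin_open)
  have "(e, 0) \<in> W" using homeo p(1) W(2) \<phi>p by (auto simp: homeomorphism_def)
  then obtain \<delta> where \<delta>: "0 < \<delta>" "ball (e, 0) \<delta> \<subseteq> W" using W(1) openE by blast
  have inV: "(e, r) \<in> V" if "r \<in> {0..<\<delta>}" for r
    using that \<delta>(2) W(2) by (auto simp: half_plane_def dist_Pair_Pair subset_eq)
  have cont: "continuous_on {0..<\<delta>} (\<lambda>r. \<psi> (e, r))"
  proof (rule continuous_on_compose2[where g = \<psi> and f = "\<lambda>r. (e, r)"])
    show "continuous_on V \<psi>" using homeo by (simp add: homeomorphism_def)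
    show "continuous_on {0..<\<delta>} (\<lambda>r. (e, r))" by (intro continuous_intros)
  qed (use inV in auto)
  have "\<psi> (e, 0) = p" using homeo p(1) \<phi>p by (auto simp: homeomorphism_def)
  moreover have "\<psi> (e, r) \<in> U \<and> snd (\<phi> (\<psi> (e, r))) = r" if "r \<in> {0..<\<delta>}" for r
    using homeo inV[OF that] by (auto simp: homeomorphism_def)
  ultimately show ?thesis using that[of \<delta> "\<lambda>r. \<psi> (e, r)"] \<delta>(1) cont by blast
qed

text \<open>The transverse component \<open>h\<close> is a single function on the whole overlap, so
  equal heights stay equal even for points in different components of it.\<close>

lemma foliated_change_level:
  assumes "foliated_change (U, \<phi>) (V, \<psi>)" "inj_on \<phi> U" "p \<in> U \<inter> V" "q \<in> U \<inter> V"
    and "snd (\<phi> p) = snd (\<phi> q)"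
  shows "snd (\<psi> p) = snd (\<psi> q)"
proof -
  obtain g h where
    gh: "\<forall>(x, y)\<in>\<phi> ` (U \<inter> V). \<psi> (the_inv_into U \<phi> (x, y)) = (g (x, y), h y :: real)"
    using assms(1) unfolding foliated_change_def prod.case by blast
  have "snd (\<psi> z) = h (snd (\<phi> z))" if "z \<in> U \<inter> V" for z
    using bspec[OF gh, of "\<phi> z"] that the_inv_into_f_f[OF assms(2), of z]
    by (auto split: prod.splits)
  then show ?thesis using assms(3-5) by simp
qed

text \<open>Only points to the left of \<open>t\<close> are recorded, so the size of a neighbourhood
  is a regressive function of \<open>t\<close> to which pressing down applies.\<close>

definition corner_triangle :: "long_ray \<Rightarrow> long_ray \<Rightarrow> (long_line \<times> long_line) set" where
  "corner_triangle a t = {p \<in> rhombic_quadrant. pos_ray a < fst p \<and> snd p \<le> pos_ray t}"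

lemma diagonal_mem_triangle:
  "a < s \<Longrightarrow> s \<le> t \<Longrightarrow> (pos_ray s, pos_ray s) \<in> corner_triangle a t"
  by (simp add: corner_triangle_def diagonal_mem_rhombic)

lemma corner_triangle_mono:
  "a \<le> a' \<Longrightarrow> t' \<le> t \<Longrightarrow> corner_triangle a' t' \<subseteq> corner_triangle a t"
  by (auto simp: corner_triangle_def elim: order_trans le_less_trans[rotated])

text \<open>A product neighbourhood contains an interval to the left of \<open>t\<close> in both
  factors; since \<open>x \<le> y\<close>, a lower bound on \<open>x\<close> and an upper bound on
  \<open>y\<close> confine both coordinates to it.\<close>

lemma openin_contains_triangle:
  assumes "openin (top_of_set rhombic_quadrant) U" "(pos_ray t, pos_ray t) \<in> U" "0 < t"
  shows "\<exists>a<t. corner_triangle a t \<subseteq> U"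
proof -
  obtain W where W: "open W" "U = rhombic_quadrant \<inter> W" using assms(1) by (auto simp: openin_open)
  then obtain S T where ST: "open S" "open T" "pos_ray t \<in> S" "pos_ray t \<in> T" "S \<times> T \<subseteq> W"
    using assms(2) by (metis IntE open_prod_elim mem_Sigma_iff)
  have "open (S \<inter> T)" "pos_ray t \<in> S \<inter> T" "pos_ray 0 < pos_ray t" using ST assms(3) by auto
  then obtain l where l: "l < pos_ray t" "{l<..pos_ray t} \<subseteq> S \<inter> T" using open_left by blast
  have "ray_part l < t"
  proof (rule ccontr)
    assume "\<not> ray_part l < t"
    then have "ray_part l = t" using ray_part_le_iff[of l t] l(1) by auto
    then show False using ray_part_eq_pos[OF _ assms(3)] l(1) by auto
  qed
  moreover have "corner_triangle (ray_part l) t \<subseteq> U"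
  proof
    fix p assume "p \<in> corner_triangle (ray_part l) t"
    then have p: "p \<in> rhombic_quadrant" "pos_ray (ray_part l) < fst p" "snd p \<le> pos_ray t"
      by (auto simp: corner_triangle_def)
    have "l < fst p" using p(2) ray_part_le_iff[of l "ray_part l"] by auto
    moreover have "fst p \<le> snd p" using p(1) by (auto simp: rhombic_quadrant_def)
    ultimately have "fst p \<in> {l<..pos_ray t}" "snd p \<in> {l<..pos_ray t}" using p(3) by auto
    then have "p \<in> S \<times> T" using l(2) by (auto simp: mem_Times_iff)
    then show "p \<in> U" using ST(5) W(2) p(1) by blast
  qed
  ultimately show ?thesis by blast
qed

lemma rhombic_quadrant_no_foliated_atlas: "\<not> foliated_atlas rhombic_quadrant rhombic_boundary A"
proof
  assume atlas: "foliated_atlas rhombic_quadrant rhombic_boundary A"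
  define d where "d t = (pos_ray t, pos_ray t)" for t
  define tri where "tri = corner_triangle"
  have "\<exists>c a. c \<in> A \<and> a < t \<and> tri a t \<subseteq> fst c" if "0 < t" for t
  proof -
    have "d t \<in> (\<Union>c\<in>A. fst c)"
      using atlas diagonal_mem_rhombic by (simp add: foliated_atlas_def d_def)
    then obtain c where c: "c \<in> A" "d t \<in> fst c" by blast
    then have "boundary_chart rhombic_quadrant rhombic_boundary c"
      using atlas by (simp add: foliated_atlas_def)
    then have "openin (top_of_set rhombic_quadrant) (fst c)"
      by (auto simp: boundary_chart_def split: prod.splits)
    then obtain a where "a < t" "tri a t \<subseteq> fst c"
      using openin_contains_triangle[of "fst c" t] c(2) \<open>0 < t\<close> by (auto simp: d_def tri_def)
    then show ?thesis using c(1) by blast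
  qed
  then obtain c a where ca: "\<And>t. 0 < t \<Longrightarrow> c t \<in> A \<and> a t < t \<and> tri (a t) t \<subseteq> fst (c t)"
    by metis
  then obtain a0 where a0: "\<And>b. \<exists>t>b. a t \<le> a0" using pressing_down_long_ray[of a] by metis
  \<comment> \<open>The charts indexed by \<open>S\<close> share the bound \<open>a0\<close>, and
    \<open>S\<close> is unbounded, so each point with first coordinate above \<open>a0\<close> lies
    in the charts of all large \<open>t \<in> S\<close>.\<close>
  define S where "S = {t. 0 < t \<and> a t \<le> a0}"
  have S_unbounded: "\<exists>t\<in>S. b < t" for b
    using a0[of b] zero_le_long_ray[of b] by (auto simp: S_def intro: le_less_trans)
  define U where "U t = fst (c t)" for t
  define \<phi> where "\<phi> t = snd (c t)" for t
  have c_eq: "c t = (U t, \<phi> t)" for t by (simp add: U_def \<phi>_def)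
  have chart: "boundary_chart rhombic_quadrant rhombic_boundary (U t, \<phi> t)" if "t \<in> S" for t
    using ca[of t] that atlas by (auto simp: foliated_atlas_def S_def c_eq)
  have triU: "tri a0 t \<subseteq> U t" if "t \<in> S" for t
  proof -
    have "tri a0 t \<subseteq> tri (a t) t"
      using that unfolding tri_def by (intro corner_triangle_mono) (auto simp: S_def)
    then show ?thesis using ca[of t] that by (auto simp: S_def U_def)
  qed
  have level: "snd (\<phi> t' p) = snd (\<phi> t' q)"
    if "t \<in> S" "t' \<in> S" "p \<in> U t \<inter> U t'" "q \<in> U t \<inter> U t'" "snd (\<phi> t p) = snd (\<phi> t q)" for t t' p q
  proof (rule foliated_change_level[OF _ _ that(3-5)])
    show "foliated_change (U t, \<phi> t) (U t', \<phi> t')"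
      using atlas ca[of t] ca[of t'] that by (auto simp: foliated_atlas_def c_eq S_def)
    show "inj_on (\<phi> t) (U t)" using chart[OF that(1)] by (rule boundary_chart_inj_on)
  qed
  have cont: "continuous_on (U t) (\<lambda>p. snd (\<phi> t p))" if "t \<in> S" for t
    using boundary_chart_continuous[OF chart[OF that]] by (rule continuous_on_snd)
  have near: "eventually (\<lambda>n. pos_ray b < fst (q n) \<and> snd (q n) \<le> pos_ray t) sequentially"
    if "q \<longlonglongrightarrow> d s" "b < s" "s < t" for q b s t
  proof -
    have "(\<lambda>n. fst (q n)) \<longlonglongrightarrow> pos_ray s" "(\<lambda>n. snd (q n)) \<longlonglongrightarrow> pos_ray s"
      using tendsto_fst[OF that(1)] tendsto_snd[OF that(1)] by (auto simp: d_def)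
    then have "eventually (\<lambda>n. pos_ray b < fst (q n)) sequentially"
      "eventually (\<lambda>n. snd (q n) < pos_ray t) sequentially"
      using that by (auto intro: order_tendstoD)
    then show ?thesis by eventually_elim auto
  qed

  obtain t0 where t0: "a0 < t0" using gt_ex by blast
  obtain t1 where t1: "t1 \<in> S" "t0 < t1" using S_unbounded by blast
  have "d t0 \<in> U t1" using triU[OF t1(1)] t0 t1(2) diagonal_mem_triangle by (auto simp: d_def tri_def)
  then obtain \<kappa> \<delta> where \<kappa>: "0 < \<delta>" "continuous_on {0..<\<delta>} \<kappa>" "\<kappa> 0 = d t0"
    "\<And>r. r \<in> {0..<\<delta>} \<Longrightarrow> \<kappa> r \<in> U t1 \<and> snd (\<phi> t1 (\<kappa> r)) = r"
    using boundary_chart_transversal[OF chart[OF t1(1)]] diagonal_mem_boundary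
    unfolding d_def by (metis (no_types, lifting))
  \<comment> \<open>The shift by 2 keeps every \<open>r n\<close> strictly below
    \<open>\<delta>\<close>, also at \<open>n = 0\<close>.\<close>
  define r where "r n = \<delta> / real (n + 2)" for n
  have r: "0 < r n" "r n < \<delta>" for n using \<kappa>(1) by (auto simp: r_def field_simps intro: add_pos_nonneg)
  have "(\<lambda>n. \<delta> / real n) \<longlonglongrightarrow> 0" by (rule lim_const_over_n)
  then have "r \<longlonglongrightarrow> 0" unfolding r_def by (rule LIMSEQ_ignore_initial_segment)
  then have \<kappa>r: "(\<lambda>n. \<kappa> (r n)) \<longlonglongrightarrow> d t0"
    using continuous_on_tendsto_compose[OF \<kappa>(2), of r 0] r \<kappa>(1,3) by (auto simp: less_imp_le)
  obtain m where m: "\<And>n. n \<ge> m \<Longrightarrow> pos_ray a0 < fst (\<kappa> (r n)) \<and> snd (\<kappa> (r n)) \<le> pos_ray t1"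
    using near[OF \<kappa>r t0 t1(2)] by (auto simp: eventually_sequentially)
  \<comment> \<open>Dropping \<open>m\<close> terms puts the whole sequence into one triangle, hence
    into every later chart from \<open>S\<close>. These points mark the leaves accumulating at
    \<open>d t0\<close>.\<close>
  define P where "P n = \<kappa> (r (n + m))" for n
  have PU: "P n \<in> U t1" for n using \<kappa>(4) r by (auto simp: P_def less_imp_le)
  have P_tri: "P n \<in> tri a0 t1" for n
    using m[of "n + m"] PU[of n] boundary_chart_subset[OF chart[OF t1(1)]]
    by (auto simp: tri_def corner_triangle_def P_def)
  have P_lim: "P \<longlonglongrightarrow> d t0" unfolding P_def using \<kappa>r by (rule LIMSEQ_ignore_initial_segment)
  have P_interior: "P n \<notin> rhombic_boundary" for n
    using boundary_chart_snd_eq_0[OF chart[OF t1(1)] PU[of n]] \<kappa>(4)[of "r (n + m)"] r[of "n + m"]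
    by (auto simp: P_def less_imp_le)
  have P_mem: "P n \<in> U t" if "t \<in> S" "t1 \<le> t" for n t
    using triU[OF that(1)] P_tri[of n] corner_triangle_mono[of a0 a0 t1 t] that(2)
    by (auto simp: tri_def)

  \<comment> \<open>The leaf through \<open>P n\<close> is closed and misses the diagonal, so it cannot go off to infinity.\<close>
  have "\<exists>b. \<forall>t\<in>S. \<forall>q\<in>tri a0 t. t1 \<le> t \<longrightarrow> snd (\<phi> t q) = snd (\<phi> t (P n)) \<longrightarrow> ray_part (fst q) \<le> b"
    for n
  proof (rule ccontr)
    \<comment> \<open>The leaf is pieced together from the levels of \<open>P n\<close> in all later
      charts; it may have several components.\<close>
    define K where "K = {q. \<exists>t\<in>S. t1 \<le> t \<and> q \<in> tri a0 t \<and> snd (\<phi> t q) = snd (\<phi> t (P n))}"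
    assume "\<not> ?thesis"
    then have "\<exists>q\<in>K. b < ray_part (fst q)" for b unfolding K_def by (force simp: not_le)
    moreover have "K \<subseteq> rhombic_quadrant" by (auto simp: K_def tri_def corner_triangle_def)
    ultimately obtain q l where q: "q \<longlonglongrightarrow> d l" "\<And>n :: nat. q n \<in> K"
      "\<And>n. a0 < ray_part (fst (q n))" "\<And>n. ray_part (snd (q n)) < l"
      using rhombic_unbounded_limit[of K a0] unfolding d_def by metis
    obtain t where t: "t \<in> S" "max l t1 < t" using S_unbounded by blast
    have qr: "q k \<in> rhombic_quadrant" for k
      using q(2)[of k] by (auto simp: K_def tri_def corner_triangle_def)
    have "a0 < l" using q(3)[of 0] q(4)[of 0] rhombic_ray_part_le[OF qr[of 0]] by auto
    then have dU: "d l \<in> U t"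
      using triU[OF t(1)] t(2) diagonal_mem_triangle[of a0 l t] by (auto simp: d_def tri_def)
    have qU: "q k \<in> U t" for k
    proof -
      have "snd (q k) \<le> pos_ray t"
        using q(4)[of k] t(2) ray_part_le_iff[of "snd (q k)" t] by auto
      then have "q k \<in> tri a0 t"
        using qr[of k] q(3)[of k] by (auto simp: tri_def corner_triangle_def less_ray_part_iff)
      then show ?thesis using triU[OF t(1)] by blast
    qed
    \<comment> \<open>Each \<open>q k\<close> comes with its own chart; comparing with
      \<open>P n\<close> transfers the equality of heights to the fixed chart of
      \<open>t\<close>.\<close>
    have "snd (\<phi> t (q k)) = snd (\<phi> t (P n))" for k
    proof -
      obtain t' where t': "t' \<in> S" "t1 \<le> t'" "q k \<in> tri a0 t'" "snd (\<phi> t' (q k)) = snd (\<phi> t' (P n))"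
        using q(2)[of k] unfolding K_def by blast
      show ?thesis
        using triU[OF t'(1)] t' t qU P_mem by (intro level[OF t'(1) t(1)]) auto
    qed
    moreover have "(\<lambda>k. snd (\<phi> t (q k))) \<longlonglongrightarrow> snd (\<phi> t (d l))"
      using continuous_on_tendsto_compose[OF cont[OF t(1)] q(1) dU] qU by simp
    \<comment> \<open>Constant heights pass to the limit, but a diagonal point has height 0 while
      the interior point \<open>P n\<close> does not.\<close>
    ultimately have "snd (\<phi> t (d l)) = snd (\<phi> t (P n))" by (simp add: LIMSEQ_const_iff)
    moreover have "snd (\<phi> t (d l)) = 0"
      using boundary_chart_snd_eq_0[OF chart[OF t(1)] dU] diagonal_mem_boundary by (simp add: d_def)
    moreover have "snd (\<phi> t (P n)) \<noteq> 0"
      using boundary_chart_snd_eq_0[OF chart[OF t(1)] P_mem] P_interior t by auto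
    ultimately show False by simp
  qed
  then obtain \<beta> where \<beta>: "\<And>n t q. t \<in> S \<Longrightarrow> q \<in> tri a0 t \<Longrightarrow> t1 \<le> t \<Longrightarrow>
      snd (\<phi> t q) = snd (\<phi> t (P n)) \<Longrightarrow> ray_part (fst q) \<le> \<beta> n"
    by metis
  obtain b where b: "\<And>n. \<beta> n < b"
    using countable_bounded_long_ray[of "range \<beta>"] by auto

  \<comment> \<open>The diagonal point \<open>d s\<close> lies beyond the bounds of all the leaves,
    while one chart of a larger \<open>t\<close> contains it together with \<open>d t0\<close> and
    every \<open>P n\<close>.\<close>
  obtain s where s: "max a0 b < s" using gt_ex by blast
  obtain t where t: "t \<in> S" "max s t1 < t" using S_unbounded by blast
  have "d s \<in> U t" using triU[OF t(1)] s t(2) diagonal_mem_triangle by (auto simp: d_def tri_def)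
  then obtain \<mu> \<epsilon> where \<mu>: "0 < \<epsilon>" "continuous_on {0..<\<epsilon>} \<mu>" "\<mu> 0 = d s"
    "\<And>r. r \<in> {0..<\<epsilon>} \<Longrightarrow> \<mu> r \<in> U t \<and> snd (\<phi> t (\<mu> r)) = r"
    using boundary_chart_transversal[OF chart[OF t(1)]] diagonal_mem_boundary
    unfolding d_def by (metis (no_types, lifting))
  \<comment> \<open>These heights tend to 0 because \<open>P\<close> converges to
    \<open>d t0\<close>. The transversal at \<open>d s\<close> therefore meets the same levels at
    points \<open>\<mu> (h n)\<close> converging to \<open>d s\<close>, whose first coordinates
    eventually exceed \<open>b\<close>.\<close>
  define h where "h n = snd (\<phi> t (P n))" for n
  have d0: "d t0 \<in> U t" 
    using triU[OF t(1)] t0 t1 t diagonal_mem_triangle[of a0 t0 t] by (auto simp: d_def tri_def)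
  have "h \<longlonglongrightarrow> snd (\<phi> t (d t0))"
    using continuous_on_tendsto_compose[OF cont[OF t(1)] P_lim d0] P_mem[OF t(1)] t(2)
    unfolding h_def by (simp add: less_imp_le)
  also have "snd (\<phi> t (d t0)) = 0"
    using boundary_chart_snd_eq_0[OF chart[OF t(1)] d0] diagonal_mem_boundary by (simp add: d_def)
  finally have h0: "h \<longlonglongrightarrow> 0" .
  have "0 \<le> h n" for n
    using boundary_chart_snd_nonneg[OF chart[OF t(1)] P_mem] t by (simp add: h_def less_imp_le)
  then have h: "eventually (\<lambda>n. h n \<in> {0..<\<epsilon>}) sequentially"
    using order_tendstoD(2)[OF h0 \<mu>(1)] by (auto elim: eventually_mono)
  then have \<mu>h: "(\<lambda>n. \<mu> (h n)) \<longlonglongrightarrow> d s"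
    using continuous_on_tendsto_compose[OF \<mu>(2) h0] \<mu>(1,3) by auto
  have "s < t" using t(2) by simp
  from near[OF \<mu>h s this] h have "eventually (\<lambda>n. False) sequentially"
  proof eventually_elim
    case (elim n)
    then have \<mu>U: "\<mu> (h n) \<in> U t" "snd (\<phi> t (\<mu> (h n))) = h n" using \<mu>(4) by auto
    have pos: "a0 < ray_part (fst (\<mu> (h n)))" "b < ray_part (fst (\<mu> (h n)))"
      using elim by (auto simp: less_ray_part_iff[symmetric])
    then have "\<mu> (h n) \<in> tri a0 t"
      using elim \<mu>U(1) boundary_chart_subset[OF chart[OF t(1)]]
      by (auto simp: tri_def corner_triangle_def less_ray_part_iff)
    then have "ray_part (fst (\<mu> (h n))) \<le> \<beta> n"
      using t \<mu>U(2) by (intro \<beta>[of t]) (auto simp: h_def)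
    with b[of n] pos(2) show ?case by auto
  qed
  then show False by simp
qed

section \<open>The two quadrants are not homeomorphic\<close>

lemma long_ray_le_of_dense:
  fixes f :: "long_ray \<Rightarrow> 'b::linorder_topology"
  assumes cont: "continuous_on UNIV f"
    and dense: "\<And>x y. x \<le> c \<Longrightarrow> x < y \<Longrightarrow> \<exists>d\<in>D. x < d \<and> d < y"
    and le: "\<And>d. d \<in> D \<Longrightarrow> f d \<le> v" and "x \<le> c"
  shows "f x \<le> v"
proof (rule ccontr)
  assume "\<not> f x \<le> v"
  then have "x \<in> f -` {v<..}" by simp
  moreover have "open (f -` {v<..})" using cont by (simp add: continuous_on_open_vimage)
  moreover obtain z where "x < z" using gt_ex by blast
  \<comment> \<open>A one-sided neighbourhood to the right exists at every point, including
    \<open>0\<close>, and contains an element of \<open>D\<close>.\<close>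
  ultimately obtain y where "x < y" "{x..<y} \<subseteq> f -` {v<..}" using open_right by blast
  moreover from this obtain d where d: "d \<in> D" "x < d" "d < y" using dense \<open>x \<le> c\<close> by blast
  ultimately have "d \<in> f -` {v<..}" by (meson atLeastLessThan_iff less_imp_le subsetD)
  then show False using le[OF d(1)] by auto
qed

lemma continuous_bounded_initial_segment:
  fixes f :: "long_ray \<Rightarrow> long_ray"
  assumes "continuous_on UNIV f"
  shows "\<exists>v. \<forall>x\<le>c. f x \<le> v"
proof -
  obtain D where D: "countable D" "\<And>x y. x \<le> c \<Longrightarrow> x < y \<Longrightarrow> \<exists>d\<in>D. x < d \<and> d < y"
    by (rule long_ray_countable_dense[of _ c]) blast
  obtain v where v: "\<forall>y\<in>f ` D. y < v"
    using countable_bounded_long_ray[of "f ` D"] D(1) by blast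
  have "f x \<le> v" if "x \<le> c" for x
  proof (rule long_ray_le_of_dense[OF assms D(2) _ that])
    show "f d \<le> v" if "d \<in> D" for d using v that by (auto intro: less_imp_le)
  qed
  then show ?thesis by blast
qed

text \<open>The step \<open>N\<close> passes the values of all \<open>f\<close> at \<open>x\<close>
  and also some \<open>t > x\<close> with \<open>f t > x\<close>. At the limit the first property
  gives \<open>f \<alpha> \<le> \<alpha>\<close> and the second
  \<open>\<alpha> \<le> f \<alpha>\<close>; monotonicity of \<open>f\<close> is not assumed.\<close>

lemma common_fixed_point_long_ray:
  fixes F :: "(long_ray \<Rightarrow> long_ray) set"
  assumes "countable F" and cont: "\<And>f. f \<in> F \<Longrightarrow> continuous_on UNIV f"
    and unbounded: "\<And>f b. f \<in> F \<Longrightarrow> \<exists>t. b < f t"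
  obtains \<alpha> where "b < \<alpha>" "\<And>f. f \<in> F \<Longrightarrow> f \<alpha> = \<alpha>"
proof -
  have "\<exists>y. x < y \<and> (\<forall>f\<in>F. f x < y \<and> (\<exists>t. x < t \<and> t < y \<and> x < f t))" for x
  proof -
    \<comment> \<open>Values up to \<open>x\<close> are bounded, so a point with a larger value must
      lie beyond \<open>x\<close>.\<close>
    have "\<exists>t. x < t \<and> x < f t" if f: "f \<in> F" for f
    proof -
      obtain v where v: "\<forall>z\<le>x. f z \<le> v"
        using continuous_bounded_initial_segment[OF cont[OF f]] by blast
      obtain t where t: "max v x < f t" using unbounded[OF f] by blast
      then have "x < t" using v by (metis leD leI max_less_iff_conj)
      with t show ?thesis by auto
    qed
    then obtain T where T: "\<And>f. f \<in> F \<Longrightarrow> x < T f \<and> x < f (T f)" by metis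
    have "countable (insert x (T ` F \<union> (\<lambda>f. f x) ` F))" using assms(1) by auto
    then obtain y where "\<forall>z\<in>insert x (T ` F \<union> (\<lambda>f. f x) ` F). z < y"
      using countable_bounded_long_ray by blast
    with T show ?thesis by (intro exI[of _ y]) auto
  qed
  then obtain N where N: "\<And>x. x < N x" "\<And>x f. f \<in> F \<Longrightarrow> f x < N x"
    "\<And>x f. f \<in> F \<Longrightarrow> \<exists>t. x < t \<and> t < N x \<and> x < f t"
    by metis
  define s where "s n = (N ^^ n) b" for n
  have s_Suc: "s (Suc n) = N (s n)" for n by (simp add: s_def)
  have "s n < s (Suc n)" for n using N(1) by (simp add: s_Suc)
  then obtain \<alpha> where \<alpha>: "s \<longlonglongrightarrow> \<alpha>" "\<And>n. s n < \<alpha>" by (rule incseq_tendsto_long_ray) blast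
  have "f \<alpha> = \<alpha>" if f: "f \<in> F" for f
  proof (rule antisym)
    have lim: "(\<lambda>n. f (t n)) \<longlonglongrightarrow> f \<alpha>" if "t \<longlonglongrightarrow> \<alpha>" for t :: "nat \<Rightarrow> long_ray"
      using continuous_on_tendsto_compose[OF cont[OF f] that] by simp
    have "f (s n) \<le> \<alpha>" for n
      using N(2)[OF f, of "s n"] \<alpha>(2)[of "Suc n"] by (simp add: s_Suc)
    then show "f \<alpha> \<le> \<alpha>" by (intro LIMSEQ_le_const2[OF lim[OF \<alpha>(1)]]) auto
    have "\<forall>n. \<exists>t. s n < t \<and> t < s (Suc n) \<and> s n < f t"
      using N(3)[OF f] by (simp add: s_Suc)
    then obtain t where t: "\<And>n. s n < t n \<and> t n < s (Suc n) \<and> s n < f (t n)" by metis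
    then have "t \<longlonglongrightarrow> \<alpha>" by (intro tendsto_squeeze_Suc[OF \<alpha>(1)]) (auto intro: less_imp_le)
    then show "\<alpha> \<le> f \<alpha>"
      using t by (intro LIMSEQ_le[OF \<alpha>(1) lim]) (auto intro: less_imp_le)
  qed
  moreover have "b < \<alpha>" using \<alpha>(2)[of 0] by (simp add: s_def)
  ultimately show ?thesis using that by blast
qed

lemma rhombic_embedding_bounded_on_strip:
  fixes h :: "long_ray \<times> long_ray \<Rightarrow> long_line \<times> long_line"
  assumes cont: "continuous_on UNIV h" and "inj h" and range: "range h \<subseteq> rhombic_quadrant"
  shows "\<exists>b. \<forall>t s. s \<le> c \<longrightarrow> ray_part (fst (h (t, s))) \<le> b"
proof -
  define x where "x p = ray_part (fst (h p))" for p
  define y where "y p = ray_part (snd (h p))" for p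
  have contx: "continuous_on UNIV (\<lambda>z. x (f z))" and conty: "continuous_on UNIV (\<lambda>z. y (f z))"
    if "continuous_on UNIV f" for f :: "long_ray \<Rightarrow> long_ray \<times> long_ray"
    unfolding x_def y_def
    by (intro continuous_on_compose2[OF continuous_ray_part] continuous_on_fst continuous_on_snd
        continuous_on_compose2[OF cont that]; simp)+
  have xy: "x p \<le> y p" for p unfolding x_def y_def using range by (intro rhombic_ray_part_le) auto
  define E where "E = {s. \<forall>b. \<exists>t. b < x (t, s)}"
  have unique: "s = s'" if s: "s \<in> E" "s' \<in> E" for s s'
  proof -
    \<comment> \<open>The second coordinates are unbounded as well since they dominate the first; at
      a common fixed point both lines hit the same diagonal point.\<close>
    define F where "F = {\<lambda>t. x (t, s), \<lambda>t. y (t, s), \<lambda>t. x (t, s'), \<lambda>t. y (t, s')}"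
    have "continuous_on UNIV (\<lambda>t :: long_ray. (t, z))" for z :: long_ray by (intro continuous_intros)
    then have "continuous_on UNIV f" if "f \<in> F" for f
      using that contx conty unfolding F_def by blast
    moreover have "\<exists>t. b < x (t, z)" "\<exists>t. b < y (t, z)" if "z \<in> E" for z b
      using that less_le_trans[OF _ xy] unfolding E_def by blast+
    then have "\<exists>t. b < f t" if "f \<in> F" for f b
      using that s unfolding F_def by blast
    moreover have "countable F" by (simp add: F_def)
    ultimately obtain \<alpha> where \<alpha>: "0 < \<alpha>" "\<And>f. f \<in> F \<Longrightarrow> f \<alpha> = \<alpha>"
      using common_fixed_point_long_ray[of F 0] by metis
    have "x (\<alpha>, s) = \<alpha>" "y (\<alpha>, s) = \<alpha>" "x (\<alpha>, s') = \<alpha>" "y (\<alpha>, s') = \<alpha>"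
      using \<alpha>(2) by (auto simp: F_def)
    then have "h (\<alpha>, s) = h (\<alpha>, s')"
      using \<alpha>(1) unfolding x_def y_def by (metis ray_part_eq_pos prod_eq_iff)
    with \<open>inj h\<close> show ?thesis by (auto dest: injD)
  qed
  then obtain e where e: "\<And>s. s \<noteq> e \<Longrightarrow> s \<notin> E" by metis
  obtain D where D: "countable D" "e \<notin> D"
    "\<And>x y. x \<le> c \<Longrightarrow> x < y \<Longrightarrow> \<exists>d\<in>D. x < d \<and> d < y"
    by (rule long_ray_countable_dense[of e c]) blast
  have "\<exists>b. \<forall>t. x (t, s) \<le> b" if "s \<in> D" for s
    using e[of s] D(2) that unfolding E_def by (force simp: not_less)
  then obtain B where B: "\<And>s t. s \<in> D \<Longrightarrow> x (t, s) \<le> B s" by metis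
  obtain b where b: "\<forall>z\<in>B ` D. z < b" using countable_bounded_long_ray[of "B ` D"] D(1) by blast
  \<comment> \<open>For fixed \<open>t\<close> the bound extends from \<open>D\<close> to all
    \<open>s \<le> c\<close> by continuity in \<open>s\<close>; it covers even the exceptional line,
    and \<open>b\<close> does not depend on \<open>t\<close>.\<close>
  have "x (t, s) \<le> b" if "s \<le> c" for t s
  proof (rule long_ray_le_of_dense[where f = "\<lambda>s. x (t, s)" and c = c and D = D])
    show "continuous_on UNIV (\<lambda>s. x (t, s))" by (intro contx continuous_intros)
    show "x (t, d) \<le> b" if "d \<in> D" for d using B[OF that, of t] b that by auto
  qed (use D(3) that in auto)
  then show ?thesis by (auto simp: x_def)
qed

text \<open>A bound on \<open>snd (g t)\<close> would keep the curve in a horizontal strip, where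
  \<open>h\<close> has bounded first coordinate, although that coordinate is \<open>t\<close> here.
  Swapping the factors gives the other claim.\<close>

lemma diagonal_preimage_unbounded:
  fixes h :: "long_ray \<times> long_ray \<Rightarrow> long_line \<times> long_line"
  assumes h: "continuous_on UNIV h" "inj h" "range h \<subseteq> rhombic_quadrant"
    and diag: "\<And>t. h (g t) = (pos_ray t, pos_ray t)"
  shows "\<exists>t. b < snd (g t)" "\<exists>t. b < fst (g t)"
proof -
  have unb: "\<exists>t. b < snd (g t)"
    if h: "continuous_on UNIV h" "inj h" "range h \<subseteq> rhombic_quadrant"
      and diag: "\<And>t. h (g t) = (pos_ray t, pos_ray t)"
    for h :: "long_ray \<times> long_ray \<Rightarrow> long_line \<times> long_line" and g
  proof (rule ccontr)
    assume "\<not> ?thesis"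
    then have g: "snd (g t) \<le> b" for t by (simp add: not_less)
    obtain c where c: "\<And>t s. s \<le> b \<Longrightarrow> ray_part (fst (h (t, s))) \<le> c"
      using rhombic_embedding_bounded_on_strip[OF h] by blast
    have "t \<le> c" for t using c[OF g, of "fst (g t)" t] by (simp add: diag)
    then show False using gt_ex[of c] by (auto simp: not_le[symmetric])
  qed
  show "\<exists>t. b < snd (g t)" using h diag by (rule unb)
  have "\<exists>t. b < snd (prod.swap (g t))"
  proof (rule unb)
    show "continuous_on UNIV (h \<circ> prod.swap)"
      unfolding o_def by (intro continuous_on_compose2[OF h(1)] continuous_on_swap) simp
    show "inj (h \<circ> prod.swap)" using h(2) by (intro inj_compose) auto
  qed (use h(3) diag in auto)
  then show "\<exists>t. b < fst (g t)" by simp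
qed

lemma rect_not_homeomorphic_rhombic: "\<not> rect_quadrant homeomorphic rhombic_quadrant"
proof
  assume "rect_quadrant homeomorphic rhombic_quadrant"
  then obtain h k where hk: "homeomorphism (UNIV :: (long_ray \<times> long_ray) set) rhombic_quadrant h k"
    by (auto simp: homeomorphic_def rect_quadrant_def)
  then have h: "continuous_on UNIV h" "inj h" "range h \<subseteq> rhombic_quadrant"
    and k: "continuous_on rhombic_quadrant k" "\<And>q. q \<in> rhombic_quadrant \<Longrightarrow> h (k q) = q"
    using inj_on_inverseI[of UNIV k h] by (auto simp: homeomorphism_def)
  define g where "g t = k (pos_ray t, pos_ray t)" for t
  define g' where "g' t = k (- pos_ray t, pos_ray t)" for t
  \<comment> \<open>Reflection carries the other boundary ray to the diagonal, so the same
    unboundedness result covers both curves.\<close>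
  define h' where "h' p = (- fst (h p), snd (h p))" for p
  have hg: "h (g t) = (pos_ray t, pos_ray t)" and hg': "h (g' t) = (- pos_ray t, pos_ray t)" for t
    using k(2) diagonal_mem_rhombic by (auto simp: g_def g'_def)
  have h': "continuous_on UNIV h'" "inj h'" "range h' \<subseteq> rhombic_quadrant"
  proof -
    show "continuous_on UNIV h'"
      unfolding h'_def
      by (intro continuous_on_Pair continuous_on_compose2[OF continuous_uminus_long_line]
          continuous_on_fst continuous_on_snd h(1)) simp
    show "inj h'"
    proof (rule injI)
      fix p q assume "h' p = h' q"
      then have "h p = h q"
        unfolding h'_def by (metis Pair_inject minus_minus_long_line prod_eq_iff)
      with h(2) show "p = q" by (rule injD)
    qed
    show "range h' \<subseteq> rhombic_quadrant"
      using h(3) by (auto simp: h'_def intro!: reflect_mem_rhombic)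
  qed
  have "h' (g' t) = (pos_ray t, pos_ray t)" for t
    by (simp add: h'_def hg' minus_minus_long_line)
  note unb = diagonal_preimage_unbounded[OF h hg] diagonal_preimage_unbounded[OF h' this]
  have contg: "continuous_on UNIV g" "continuous_on UNIV g'"
    unfolding g_def g'_def
    by (intro continuous_on_compose2[OF k(1)] continuous_on_Pair continuous_pos_ray
        continuous_on_compose2[OF continuous_uminus_long_line]; auto simp: diagonal_mem_rhombic)+
  define F where "F = {\<lambda>t. fst (g t), \<lambda>t. snd (g t), \<lambda>t. fst (g' t), \<lambda>t. snd (g' t)}"
  have "continuous_on UNIV f" if "f \<in> F" for f
    using that contg by (auto simp: F_def intro: continuous_on_fst continuous_on_snd)
  moreover have "\<exists>t. b < f t" if "f \<in> F" for f b using that unb by (auto simp: F_def)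
  moreover have "countable F" by (simp add: F_def)
  ultimately obtain \<alpha> where \<alpha>: "0 < \<alpha>" "\<And>f. f \<in> F \<Longrightarrow> f \<alpha> = \<alpha>"
    using common_fixed_point_long_ray[of F 0] by metis
  have "fst (g \<alpha>) = \<alpha>" "snd (g \<alpha>) = \<alpha>" "fst (g' \<alpha>) = \<alpha>" "snd (g' \<alpha>) = \<alpha>"
    using \<alpha>(2) by (auto simp: F_def)
  \<comment> \<open>Both curves pass through \<open>(\<alpha>, \<alpha>)\<close> at time
    \<open>\<alpha>\<close>, so \<open>h\<close> would send this point to two distinct boundary
    points.\<close>
  then have "g \<alpha> = g' \<alpha>" by (simp add: prod_eq_iff)
  then have "pos_ray \<alpha> = - pos_ray \<alpha>" using hg[of \<alpha>] hg'[of \<alpha>] by simp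
  then have "Rep_long_line (pos_ray \<alpha>) = Rep_long_line (- pos_ray \<alpha>)" by simp
  then show False using \<alpha>(1) by (simp add: Rep_pos_ray Rep_uminus_long_line split: if_splits)
qed

theorem corollary7p9:
  shows "(\<exists>A. foliation_tangent_to_boundary rect_quadrant rect_boundary A) \<and>
    \<not> (\<exists>A. foliation_tangent_to_boundary rhombic_quadrant rhombic_boundary A) \<and>
    \<not> rect_quadrant homeomorphic rhombic_quadrant"
proof (intro conjI)
  show "\<exists>A. foliation_tangent_to_boundary rect_quadrant rect_boundary A"
    using rect_quadrant_foliated_atlas by (auto intro: foliated_atlas_imp_foliation)
  show "\<not> (\<exists>A. foliation_tangent_to_boundary rhombic_quadrant rhombic_boundary A)"
    using rhombic_quadrant_no_foliated_atlas by (simp add: foliation_tangent_to_boundary_def)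
  show "\<not> rect_quadrant homeomorphic rhombic_quadrant"
    by (rule rect_not_homeomorphic_rhombic)
qed

end
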